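(* Let $w\in\mathbb{C}$. For $z\in\mathbb{C}$ with $\mathrm{Re}(z)>-1$ and $|\arg x|<\frac{\pi}{4}$, $$K_{z,w}(x)=\frac{1}{2\Gamma(1+z)}\int_{0}^{\infty}\int_{0}^{\infty}\frac{y^zt^{-1/2}}{\sqrt{y+\frac x2}}\exp\left(-2\sqrt{\left(t+\frac x2\right)\left(y+\frac x2\right)}\right){}_0F_2\left(-;\frac12,1+z;-\frac{w^2xy}{8}\right){}_0F_2\left(-;\frac12,\frac12;-\frac{w^2xt}{8}\right)dt\,dy.$$
   Context: The generalized modified Bessel function is defined, for $z,w\in\mathbb{C}$, by $$K_{z,w}(x):=\frac{1}{2\pi i}\int_{c-i\infty}^{c+i\infty}\Gamma\left(\tfrac{s-z}{2}\right)\Gamma\left(\tfrac{s+z}{2}\right)\,{}_1F_1\left(\tfrac{s-z}{2};\tfrac12;-\tfrac{w^2}{4}\right){}_1F_1\left(\tfrac{s+z}{2};\tfrac12;-\tfrac{w^2}{4}\right)2^{s-2}x^{-s}\,ds,$$ where $c=\mathrm{Re}(s)>|\mathrm{Re}(z)|$ and powers of $x$ and square roots are principal. Here ${}_1F_1(a;c;u)=\sum_{n\ge0}\frac{(a)_n u^n}{(c)_n n!}$ and ${}_0F_2(-;a,b;u)=\sum_{n\ge0}\frac{u^n}{(a)_n(b)_n n!}$, with $(a)_n=a(a+1)\cdots(a+n-1)$. *)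

theory Defs
  imports "HOL-Complex_Analysis.Complex_Analysis"
begin

definition hyp_1F1 :: "complex \<Rightarrow> complex \<Rightarrow> complex \<Rightarrow> complex" where
  "hyp_1F1 a c u = (\<Sum>n. pochhammer a n * u ^ n / (pochhammer c n * fact n))"

definition hyp_0F2 :: "complex \<Rightarrow> complex \<Rightarrow> complex \<Rightarrow> complex" where
  "hyp_0F2 a b u = (\<Sum>n. u ^ n / (pochhammer a n * pochhammer b n * fact n))"

(* The integral of f along the upward line Re s = c, parametrised by s = c + i t,
   so that ds = i dt.  Being a Lebesgue integral, it has the value 0 by convention
   when f is not absolutely integrable along the line. *)
definition vertical_integrable :: "real \<Rightarrow> (complex \<Rightarrow> complex) \<Rightarrow> bool" where
  "vertical_integrable c f \<longleftrightarrow> integrable lborel (\<lambda>t. f (Complex c t) * \<i>)"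

definition vertical_integral :: "real \<Rightarrow> (complex \<Rightarrow> complex) \<Rightarrow> complex" where
  "vertical_integral c f = (LINT t|lborel. f (Complex c t) * \<i>)"

definition bessel_K_integrand :: "complex \<Rightarrow> complex \<Rightarrow> complex \<Rightarrow> complex \<Rightarrow> complex" where
  "bessel_K_integrand z w x s =
     Gamma ((s - z) / 2) * Gamma ((s + z) / 2)
     * hyp_1F1 ((s - z) / 2) (1 / 2) (- (w\<^sup>2 / 4))
     * hyp_1F1 ((s + z) / 2) (1 / 2) (- (w\<^sup>2 / 4))
     * 2 powr (s - 2) * x powr (- s)"

(* The generalized modified Bessel function K_{z,w}(x).  The abscissa c of the line of
   integration is kept as a parameter; the function is meant for any c > |Re z|. *)
definition bessel_K :: "real \<Rightarrow> complex \<Rightarrow> complex \<Rightarrow> complex \<Rightarrow> complex" where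
  "bessel_K c z w x = 1 / (2 * of_real pi * \<i>) * vertical_integral c (bessel_K_integrand z w x)"

end

theory Submission
  imports Defs "HOL-Probability.Probability" "HOL-Real_Asymp.Real_Asymp"
begin

text \<open>Put \<open>X = x / 2\<close>, choose \<open>k\<close> with \<open>k\<^sup>2 = w\<^sup>2 X\<close>, and let
\<open>h r = exp (- X r) cos (k sqrt r)\<close>. Both sides of the identity equal the single integral
\<open>1/2 * \<integral>\<^sub>0\<^sup>\<infinity> t powr (- z - 1) * h t * h (1 / t) dt\<close>,
which for \<open>w = 0\<close> is a classical integral representation of the modified Bessel function.

The Mellin-Barnes side (\<open>bessel_K_single_integral\<close>): expanding the cosine shows that the Mellin
transform of \<open>h\<close> at \<open>a\<close> is \<open>Gamma a * 1F1 (a; 1/2; - w\<^sup>2/4) * X powr (- a)\<close>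
(\<open>mellin_exp_cos\<close>). The product of its values at \<open>a = (s - z)/2\<close> and \<open>a = (s + z)/2\<close> is,
up to the factor 4, the integrand of \<open>K\<close> at \<open>s\<close>, with the power of \<open>x\<close> already included. So the vertical
integral is a Parseval integral for Mellin transforms (\<open>mellin_parseval\<close>), which rests on pointwise
Mellin inversion of \<open>h\<close>. The required decay on vertical lines comes from turning the ray of integration:
replacing \<open>X\<close> by \<open>exp (\<plusminus> \<i> \<theta>)\<close> only changes the factor \<open>X powr (- a)\<close>, so
\<open>Gamma a * 1F1 a\<close> is \<open>O(exp (- \<theta> \<bar>Im a\<bar>))\<close> for every \<open>\<theta> < pi/2\<close>, and this beats the growth
\<open>exp (\<bar>Arg X\<bar> \<bar>Im a\<bar>)\<close> of \<open>X powr (- a)\<close> (\<open>gamma_1F1_decay\<close>).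

The double integral side (\<open>iterated_integral_single_integral\<close>): for \<open>A = t + X\<close> and \<open>B = y + X\<close>,
\<open>exp (- 2 csqrt (A B)) / csqrt B\<close> is \<open>1 / sqrt pi\<close> times the integral over \<open>s > 0\<close> of
\<open>exp (- B s - A / s) / sqrt s\<close> (\<open>exp_csqrt_product_integral\<close>). In this form the variables \<open>y\<close> and
\<open>t\<close> separate, and they enter only through Laplace transforms of \<open>0F2\<close> at \<open>s\<close> and at \<open>1 / s\<close>.
These are again cosines (\<open>laplace_hyp_0F2\<close>), and the two applications of Fubini's theorem
(\<open>laplace_fubini\<close>) are justified because \<open>0F2 (u)\<close> grows more slowly than
\<open>exp (\<epsilon> sqrt \<bar>u\<bar>)\<close> for every \<open>\<epsilon> > 0\<close> (\<open>hyp_0F2_bound\<close>).\<close>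

section \<open>Laplace transforms of power series\<close>

lemma set_integrable_powr_exp_complex:
  fixes a p :: complex
  assumes "Re a > 0" "Re p > 0"
  shows "set_integrable lborel {0<..} (\<lambda>r. of_real r powr (a - 1) * exp (- p * of_real r))"
proof -
  have *: "set_integrable lborel {0<..} (\<lambda>r. of_real r powr (a - 1) / of_real (exp (Re p * r)) :: complex)"
    using absolutely_integrable_Gamma_integral[OF assms]
    unfolding set_integrable_def absolutely_integrable_on_def
    by (subst integrable_completion [symmetric]) (auto simp: )
  show ?thesis
    unfolding set_integrable_def
  proof (rule Bochner_Integration.integrable_bound[OF *[unfolded set_integrable_def]])
    show "AE x in lborel. norm (indicator {0<..} x *\<^sub>R (of_real x powr (a - 1) * exp (- p * of_real x)))
       \<le> norm (indicator {0<..} x *\<^sub>R (of_real x powr (a - 1) / complex_of_real (exp (Re p * x))))"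
      by (intro AE_I2) (auto simp: indicator_def norm_mult norm_divide exp_minus field_simps)
  qed (measurable)
qed

lemma set_integral_powr_exp_scaled:
  fixes a :: complex and l :: real
  assumes "Re a > 0" "l > 0"
  shows "(LBINT r:{0<..}. of_real r powr (a - 1) * exp (- of_real (l * r))) = Gamma a * of_real l powr (- a)"
proof -
  have i1: "set_integrable lborel {0<..} (\<lambda>r. of_real r powr (a - 1) * exp (- of_real r) :: complex)"
    using set_integrable_powr_exp_complex[of a 1] assms by simp
  have "integral {0<..} (\<lambda>r. of_real r powr (a - 1) * exp (- of_real r)) = Gamma a"
    using Gamma_integral_complex'[OF assms(1)] 
    by (simp add: has_integral_iff exp_minus divide_inverse exp_of_real of_real_inverse del: of_real_exp)
  with set_borel_integral_eq_integral(2)[OF i1] 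
  have 1: "(LBINT r:{0<..}. of_real r powr (a - 1) * exp (- of_real r)) = Gamma a" by simp
  have "Gamma a = (LBINT r. indicator {0<..} r *\<^sub>R (of_real r powr (a - 1) * exp (- of_real r)))"
    using 1 by (simp add: set_lebesgue_integral_def)
  also have "\<dots> = \<bar>l\<bar> *\<^sub>R (LBINT r. indicator {0<..} (0 + l * r) *\<^sub>R (of_real (0 + l*r) powr (a - 1) * exp (- of_real (0 + l * r))))"
    using assms by (subst lborel_integral_real_affine[where c=l and t=0]) auto
  also have "\<dots> = of_real l * (LBINT r. of_real l powr (a-1) * (indicator {0<..} r *\<^sub>R (of_real r powr (a - 1) * exp (- of_real (l * r)))))"
  proof -
    have "indicator {0<..} (0 + l * r) *\<^sub>R (of_real (0 + l*r) powr (a - 1) * exp (- of_real (0 + l * r)))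
      = of_real l powr (a-1) * (indicator {0<..} r *\<^sub>R (of_real r powr (a - 1) * exp (- of_real (l * r) :: complex)))" for r
      using assms by (auto simp: indicator_def zero_less_mult_iff powr_times_real)
    note eq = this
    show ?thesis
      using assms unfolding eq by (simp only: abs_of_pos scaleR_conv_of_real[of l])
  qed
  also have "\<dots> = of_real l * of_real l powr (a-1) * (LBINT r:{0<..}. of_real r powr (a - 1) * exp (- of_real (l * r)))"
    by (simp only: set_lebesgue_integral_def integral_mult_right_zero mult.assoc)
  finally show ?thesis
    using assms by (simp add: powr_minus powr_diff field_simps)
qed

lemma real_powr_exp:
  fixes a l :: real
  assumes "a > 0" "l > 0"
  shows set_integrable_powr_exp: "set_integrable lborel {0<..} (\<lambda>r. r powr (a - 1) * exp (- l * r))"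
    and set_integral_powr_exp: "(LBINT r:{0<..}. r powr (a - 1) * exp (- l * r)) = Gamma a * l powr (- a)"
proof -
  have *: "set_integrable lborel {0<..} (\<lambda>r. of_real r powr (of_real a - 1) * exp (- of_real l * of_real r) :: complex)"
    using set_integrable_powr_exp_complex[of "of_real a" "of_real l"] assms by simp
  have eq: "indicator {0<..} r *\<^sub>R (of_real r powr (of_real a - 1) * exp (- of_real l * of_real r))
     = complex_of_real (indicator {0<..} r *\<^sub>R (r powr (a-1) * exp (- l * r)))" for r
    by (auto simp: indicator_def powr_of_real[symmetric] exp_of_real[symmetric])
  show 1: "set_integrable lborel {0<..} (\<lambda>r. r powr (a - 1) * exp (- l * r))"
    using * unfolding set_integrable_def eq by (simp only: complex_of_real_integrable_eq)
  have "of_real (LBINT r:{0<..}. r powr (a - 1) * exp (- l * r)) = (LBINT r:{0<..}. of_real r powr (of_real a - 1) * exp (- of_real (l * r)) :: complex)"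
    unfolding set_lebesgue_integral_def using eq by (simp add: integral_complex_of_real[symmetric] del: integral_complex_of_real) 
  also have "\<dots> = complex_of_real (Gamma a * l powr (- a))"
    using set_integral_powr_exp_scaled[of "of_real a" l] assms 
    by (simp add: Gamma_complex_of_real powr_of_real[symmetric])
  finally show "(LBINT r:{0<..}. r powr (a - 1) * exp (- l * r)) = Gamma a * l powr (- a)"
    by (simp only: of_real_eq_iff)
qed

text \<open>Fubini for sums: the summability hypothesis is the absolute convergence of the integrated series, since
\<open>Gamma (Re b + n) * Re p powr (- (Re b + n))\<close> is the integral of the modulus of the \<open>n\<close>-th monomial. The
integrals of the monomials are left unevaluated here, because their value for complex \<open>p\<close> is itself
obtained from this lemma.\<close>
lemma laplace_termwise_sums:
  fixes b p :: complex and c :: "nat \<Rightarrow> complex"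
  assumes b: "Re b > 0" and p: "Re p > 0"
    and pt: "\<And>r::real. summable (\<lambda>n. norm (c n) * r ^ n)"
    and sm: "summable (\<lambda>n. norm (c n) * Gamma (Re b + n) * Re p powr (- (Re b + n)))"
  shows "set_integrable lborel {0<..} (\<lambda>r. of_real r powr (b - 1) * exp (- p * of_real r) * (\<Sum>n. c n * of_real r ^ n))"
    and "(\<lambda>n. c n * (LBINT r:{0<..}. of_real r powr (b + of_nat n - 1) * exp (- p * of_real r))) sums
         (LBINT r:{0<..}. of_real r powr (b - 1) * exp (- p * of_real r) * (\<Sum>n. c n * of_real r ^ n))"
proof -
  define f where "f = (\<lambda>n (r::real). indicator {0<..} r *\<^sub>R (c n * (of_real r powr (b + of_nat n - 1) * exp (- p * of_real r))))"
  have f_int: "integrable lborel (f n)" for n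
  proof -
    have "integrable lborel (\<lambda>r. c n * (indicator {0<..} r *\<^sub>R (of_real r powr (b + of_nat n - 1) * exp (- p * of_real r))))"
      using set_integrable_powr_exp_complex[of "b + of_nat n" p] b p
      by (intro integrable_mult_right) (simp add: set_integrable_def)
    then show ?thesis unfolding f_def by (simp only: mult_scaleR_right)
  qed
  have f_eq: "f n r = indicator {0<..} r *\<^sub>R (of_real r powr (b - 1) * exp (- p * of_real r)) * (c n * of_real r ^ n)" for n r
    unfolding f_def by (auto simp: indicator_def powr_diff powr_add powr_nat' field_simps)
  have s1: "summable (\<lambda>n. c n * of_real r ^ n)" for r :: real
    using pt[of "\<bar>r\<bar>"] by (intro summable_norm_cancel[of "\<lambda>n. c n * of_real r ^ n"]) (simp add: norm_mult norm_power)
  have s2: "summable (\<lambda>n. norm (f n r))" for r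
    unfolding f_eq norm_mult norm_power using pt[of "\<bar>r\<bar>"]
    by (intro summable_mult) (simp add: norm_mult norm_power)
  have n: "(LBINT r. norm (f n r)) = norm (c n) * Gamma (Re b + n) * Re p powr (- (Re b + n))" for n
  proof -
    have "(LBINT r. norm (f n r)) = (LBINT r. norm (c n) * (indicator {0<..} r *\<^sub>R (r powr (Re b + n - 1) * exp (- Re p * r))))"
      by (intro Bochner_Integration.integral_cong) (auto simp: f_def indicator_def norm_mult norm_powr_real_powr)
    also have "\<dots> = norm (c n) * (LBINT r:{0<..}. (r powr (Re b + n - 1) * exp (- Re p * r)))"
      by (simp add: set_lebesgue_integral_def)
    finally show ?thesis using set_integral_powr_exp[of "Re b + n" "Re p"] b p by simp
  qed
  have sum_f: "(\<Sum>n. f n r) = indicator {0<..} r *\<^sub>R (of_real r powr (b - 1) * exp (- p * of_real r) * (\<Sum>n. c n * of_real r ^ n))" for r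
    unfolding f_eq by (subst suminf_mult[OF s1]) simp
  have sm': "summable (\<lambda>n. LBINT r. norm (f n r))" unfolding n by (rule sm)
  show "set_integrable lborel {0<..} (\<lambda>r. of_real r powr (b - 1) * exp (- p * of_real r) * (\<Sum>n. c n * of_real r ^ n))"
    unfolding set_integrable_def sum_f[symmetric]
    by (rule integrable_suminf[OF f_int _ sm']) (use s2 in auto)
  have "(\<lambda>n. LBINT r. f n r) sums (LBINT r. (\<Sum>n. f n r))"
    by (rule sums_integral[OF f_int _ sm']) (use s2 in auto)
  then show "(\<lambda>n. c n * (LBINT r:{0<..}. of_real r powr (b + of_nat n - 1) * exp (- p * of_real r))) sums
         (LBINT r:{0<..}. of_real r powr (b - 1) * exp (- p * of_real r) * (\<Sum>n. c n * of_real r ^ n))"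
    by (simp only: sum_f set_lebesgue_integral_def[symmetric])
       (simp only: f_def set_lebesgue_integral_def mult_scaleR_right[symmetric] integral_mult_right_zero)
qed

lemma summable_ratio_tendsto:
  fixes f :: "nat \<Rightarrow> real"
  assumes "\<And>n. f n \<ge> 0" "\<And>n. f (Suc n) \<le> q n * f n" "q \<longlonglongrightarrow> L" "L < 1"
  shows "summable f"
proof -
  obtain c where c: "L < c" "c < 1" using dense[OF assms(4)] by blast
  from order_tendstoD(2)[OF assms(3) c(1)] obtain N where N: "\<And>n. n \<ge> N \<Longrightarrow> q n < c"
    by (auto simp: eventually_sequentially)
  show ?thesis
  proof (rule summable_ratio_test[OF c(2)])
    fix n assume "n \<ge> N"
    have "f (Suc n) \<le> q n * f n" by fact
    also have "\<dots> \<le> c * f n" using N[OF \<open>n \<ge> N\<close>] assms(1) by (intro mult_right_mono) auto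
    finally show "norm (f (Suc n)) \<le> c * norm (f n)" using assms(1) by simp
  qed
qed

lemma Gamma_real_add_nat:
  assumes "(a::real) > 0"
  shows "Gamma (a + Suc n) = (a + n) * Gamma (a + n)"
proof -
  have "a + n \<notin> \<int>\<^sub>\<le>\<^sub>0" using nonpos_Ints_nonpos[of "a + n"] assms by fastforce
  from Gamma_plus1[OF this] show ?thesis by (simp add: add_ac)
qed

lemma Gamma_complex_add_nat:
  assumes "Re a > 0"
  shows "Gamma (a + of_nat n) = pochhammer a n * Gamma a"
proof -
  have "a \<notin> \<int>\<^sub>\<le>\<^sub>0" using assms by (auto elim!: nonpos_Ints_cases)
  then show ?thesis using pochhammer_Gamma[of a n] by (simp add: Gamma_eq_zero_iff)
qed

text \<open>Instead of rotating the contour, \<open>exp (- p r)\<close> is expanded around \<open>exp (- l r)\<close> with \<open>l\<close> real, and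
the integrated series is the binomial series of \<open>(1 + (p - l) / l) powr (- a)\<close>. It converges when
\<open>\<bar>p - l\<bar> < l\<close>, and such an \<open>l\<close> exists for every \<open>p\<close> in the right half-plane.\<close>
lemma set_integral_powr_exp_complex:
  fixes a p :: complex
  assumes a: "Re a > 0" and p: "Re p > 0"
  shows "(LBINT r:{0<..}. of_real r powr (a - 1) * exp (- p * of_real r)) = Gamma a * p powr (- a)"
proof -
  \<comment> \<open>The distance from \<open>l\<close> to \<open>p\<close> is less than \<open>l\<close> exactly when \<open>2 l Re p > \<bar>p\<bar>\<^sup>2\<close>.\<close>
  define l where "l = (norm p)\<^sup>2 / Re p"
  have p0: "p \<noteq> 0" using p by auto
  have l: "l > 0" using p p0 by (simp add: l_def)
  have "(norm (p - of_real l))\<^sup>2 = (norm p)\<^sup>2 - 2 * l * Re p + l\<^sup>2"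
    unfolding cmod_power2 by (simp add: power2_eq_square algebra_simps)
  also have "\<dots> = l\<^sup>2 - (norm p)\<^sup>2" using p by (simp add: l_def field_simps)
  also have "\<dots> < l\<^sup>2" using p0 by simp
  finally have lt: "norm (p - of_real l) < l" using l by (simp add: power_less_imp_less_base)
  define c where "c = (\<lambda>n. (- (p - of_real l)) ^ n / fact n)"
  have c_sums: "(\<lambda>n. c n * of_real r ^ n) sums exp (- (p - of_real l) * of_real r)" for r :: real
  proof -
    have "(\<lambda>n. (- (p - of_real l) * of_real r) ^ n /\<^sub>R fact n) sums exp (- (p - of_real l) * of_real r)"
      by (rule exp_converges)
    moreover have "(- (p - of_real l) * of_real r) ^ n /\<^sub>R fact n = c n * of_real r ^ n" for n
      by (simp only: power_mult_distrib c_def) (simp add: scaleR_conv_of_real divide_inverse mult_ac)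
    ultimately show ?thesis by simp
  qed
  have "(\<lambda>n. c n * (LBINT r:{0<..}. of_real r powr (a + of_nat n - 1) * exp (- of_real l * of_real r))) sums
         (LBINT r:{0<..}. of_real r powr (a - 1) * exp (- of_real l * of_real r) * (\<Sum>n. c n * of_real r ^ n))"
  proof (rule laplace_termwise_sums(2))
    fix r :: real
    have "summable (\<lambda>n. (norm (p - of_real l) * r) ^ n /\<^sub>R fact n)"
      by (rule summable_exp_generic)
    then show "summable (\<lambda>n. norm (c n) * r ^ n)"
      by (simp add: c_def norm_divide norm_power norm_minus_commute power_mult_distrib divide_simps)
  next
    have ratio: "norm (c (Suc n)) = norm (c n) * (norm (p - of_real l) / (real n + 1))" for n
    proof -
      have "c (Suc n) = c n * (- (p - of_real l) / of_nat (Suc n))" by (simp add: c_def mult_ac)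
      also have "norm \<dots> = norm (c n) * (norm (p - of_real l) / (real n + 1))"
        by (simp only: norm_mult norm_divide norm_minus_cancel norm_of_nat) simp
      finally show ?thesis .
    qed
    let ?q = "\<lambda>n. norm (p - of_real l) / l * ((Re a + real n) / (real n + 1))"
    show "summable (\<lambda>n. norm (c n) * Gamma (Re a + n) * Re (of_real l) powr - (Re a + n))"
    proof (rule summable_ratio_tendsto)
      show "0 \<le> norm (c n) * Gamma (Re a + n) * Re (of_real l) powr - (Re a + n)" for n
        using a by (intro mult_nonneg_nonneg) (auto intro: less_imp_le)
      show "norm (c (Suc n)) * Gamma (Re a + Suc n) * Re (of_real l) powr - (Re a + Suc n)
        \<le> ?q n * (norm (c n) * Gamma (Re a + n) * Re (of_real l) powr - (Re a + n))" for n
        using l a unfolding ratio by (subst Gamma_real_add_nat)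
          (auto simp: powr_diff powr_minus powr_add field_simps)
      have "(\<lambda>n. (Re a + real n) / (real n + 1)) \<longlonglongrightarrow> 1" by real_asymp
      from tendsto_mult_left[OF this] show "?q \<longlonglongrightarrow> norm (p - of_real l) / l * 1" .
      show "norm (p - of_real l) / l * 1 < 1" using lt l by simp
    qed
  qed (use a l in auto)
  also have "(\<lambda>r. of_real r powr (a - 1) * exp (- of_real l * of_real r) * (\<Sum>n. c n * of_real r ^ n))
     = (\<lambda>r::real. of_real r powr (a - 1) * exp (- p * of_real r))"
    unfolding sums_unique[OF c_sums, symmetric] mult.assoc exp_add[symmetric] by (simp add: algebra_simps)
  also have "(\<lambda>n. c n * (LBINT r:{0<..}. of_real r powr (a + of_nat n - 1) * exp (- of_real l * of_real r)))
     = (\<lambda>n. Gamma a * of_real l powr (- a) * (((- a) gchoose n) * ((p - of_real l) / of_real l) ^ n))"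
  proof
    fix n
    have "(LBINT r:{0<..}. of_real r powr (a + of_nat n - 1) * exp (- of_real l * of_real r))
      = Gamma (a + of_nat n) * of_real l powr (- (a + of_nat n))"
      using set_integral_powr_exp_scaled[of "a + of_nat n" l] a l by simp
    also have "\<dots> = Gamma a * of_real l powr (- a) * (pochhammer a n / of_real l ^ n)"
      using l by (simp add: Gamma_complex_add_nat[OF a] powr_diff powr_minus powr_add powr_nat' field_simps)
    finally show "c n * (LBINT r:{0<..}. of_real r powr (a + of_nat n - 1) * exp (- of_real l * of_real r)) =
       Gamma a * of_real l powr (- a) * (((- a) gchoose n) * ((p - of_real l) / of_real l) ^ n)"
      unfolding c_def gbinomial_pochhammer power_minus[of "p - of_real l"] by (simp add: power_divide)
  qed
  finally have 1: "(\<lambda>n. Gamma a * of_real l powr (- a) * (((- a) gchoose n) * ((p - of_real l) / of_real l) ^ n)) sums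
      (LBINT r:{0<..}. of_real r powr (a - 1) * exp (- p * of_real r))" .
  have "(\<lambda>n. ((- a) gchoose n) * ((p - of_real l) / of_real l) ^ n) sums (1 + (p - of_real l) / of_real l) powr (- a)"
    using lt l by (intro gen_binomial_complex) (simp add: norm_divide)
  from sums_unique2[OF 1 sums_mult[OF this]]
  have "(LBINT r:{0<..}. of_real r powr (a - 1) * exp (- p * of_real r)) =
    Gamma a * of_real l powr (- a) * (1 + (p - of_real l) / of_real l) powr (- a)"
    by simp
  also have "1 + (p - of_real l) / of_real l = of_real (1 / l) * p" using l by (simp add: field_simps)
  finally have *: "(LBINT r:{0<..}. of_real r powr (a - 1) * exp (- p * of_real r)) =
    Gamma a * (of_real l powr (- a) * (of_real (1 / l) * p) powr (- a))" by (simp only: mult.assoc)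
  also have "of_real l powr (- a) * (of_real (1 / l) * p) powr (- a) = p powr (- a)"
  proof -
    have "Ln (of_real (1 / l) * p) = of_real (ln (1 / l)) + Ln p"
      using l p0 Ln_times_of_real[of "1 / l" p] Ln_of_real[of "1 / l"] by simp
    also have "of_real (ln (1 / l)) = - Ln (of_real l)" using l by (simp add: Ln_of_real ln_div)
    finally have "Ln (of_real (1 / l) * p) = - Ln (of_real l) + Ln p" .
    moreover have "of_real (1 / l) * p \<noteq> 0" using l p0 by simp
    ultimately show ?thesis
      using l p0 by (simp only: powr_def if_False) (simp add: exp_add[symmetric] algebra_simps)
  qed
  finally show ?thesis .
qed

lemma laplace_termwise:
  fixes b p :: complex and c :: "nat \<Rightarrow> complex"
  assumes b: "Re b > 0" and p: "Re p > 0"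
    and pt: "\<And>r::real. summable (\<lambda>n. norm (c n) * r ^ n)"
    and sm: "summable (\<lambda>n. norm (c n) * Gamma (Re b + n) * Re p powr (- (Re b + n)))"
  shows "set_integrable lborel {0<..} (\<lambda>r. of_real r powr (b - 1) * exp (- p * of_real r) * (\<Sum>n. c n * of_real r ^ n))"
    and "(LBINT r:{0<..}. of_real r powr (b - 1) * exp (- p * of_real r) * (\<Sum>n. c n * of_real r ^ n))
         = Gamma b * p powr (- b) * (\<Sum>n. c n * pochhammer b n / p ^ n)"
proof -
  show "set_integrable lborel {0<..} (\<lambda>r. of_real r powr (b - 1) * exp (- p * of_real r) * (\<Sum>n. c n * of_real r ^ n))"
    by (rule laplace_termwise_sums(1)[OF assms])
  have p0: "p \<noteq> 0" using p by auto
  have G0: "Gamma b * p powr (- b) \<noteq> 0" using b p0 by (auto simp: Gamma_eq_zero_iff elim!: nonpos_Ints_cases)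
  have "c n * (LBINT r:{0<..}. of_real r powr (b + of_nat n - 1) * exp (- p * of_real r)) 
    = Gamma b * p powr (- b) * (c n * pochhammer b n / p ^ n)" for n
    using set_integral_powr_exp_complex[of "b + of_nat n" p] b p p0
    by (simp add: Gamma_complex_add_nat[OF b] powr_diff powr_minus powr_add powr_nat' field_simps)
  with laplace_termwise_sums(2)[OF assms]
  have *: "(\<lambda>n. Gamma b * p powr (- b) * (c n * pochhammer b n / p ^ n)) sums
     (LBINT r:{0<..}. of_real r powr (b - 1) * exp (- p * of_real r) * (\<Sum>n. c n * of_real r ^ n))" by simp
  have "summable (\<lambda>n. c n * pochhammer b n / p ^ n)"
    using summable_mult[OF sums_summable[OF *], of "1 / (Gamma b * p powr (- b))"] G0 by (simp add: field_simps)
  from sums_unique[OF *] suminf_mult[OF this, of "Gamma b * p powr (- b)"]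
  show "(LBINT r:{0<..}. of_real r powr (b - 1) * exp (- p * of_real r) * (\<Sum>n. c n * of_real r ^ n))
         = Gamma b * p powr (- b) * (\<Sum>n. c n * pochhammer b n / p ^ n)" by simp
qed

lemma cos_series_square:
  fixes u :: complex
  shows "(\<lambda>n. (- (u\<^sup>2)) ^ n / fact (2 * n)) sums cos u"
proof -
  have "strict_mono (\<lambda>n::nat. 2 * n)" by (simp add: strict_mono_def)
  moreover have "cos_coeff n *\<^sub>R u ^ n = 0" if "n \<notin> range (\<lambda>n. 2 * n)" for n
    using that by (auto simp: cos_coeff_def elim!: evenE)
  ultimately have "(\<lambda>n. cos_coeff (2 * n) *\<^sub>R u ^ (2 * n)) sums cos u"
    using cos_converges[of u] sums_mono_reindex[of "\<lambda>n::nat. 2 * n" "\<lambda>n. cos_coeff n *\<^sub>R u ^ n"] by simp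
  moreover have "cos_coeff (2 * n) *\<^sub>R u ^ (2 * n) = (- (u\<^sup>2)) ^ n / fact (2 * n)" for n
    by (simp add: cos_coeff_def scaleR_conv_of_real power_mult power_minus[of "u\<^sup>2"])
  ultimately show ?thesis by simp
qed

lemma fact_double_pochhammer:
  "(fact (2 * n) :: complex) = 4 ^ n * pochhammer (1/2) n * fact n"
  unfolding fact_double power_mult by simp

section \<open>Laplace transforms of cosine and 0F2\<close>

text \<open>The cosine series in \<open>r\<close> has coefficients \<open>(- k\<^sup>2)^n / (2n)!\<close> and \<open>(2n)! = 4^n (1/2)\<^sub>n n!\<close>, so
termwise integration produces exactly the coefficients of \<open>1F1\<close> with lower parameter \<open>1/2\<close>.\<close>
lemma laplace_cos_sqrt:
  fixes a p k :: complex
  assumes a: "Re a > 0" and p: "Re p > 0"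
  shows "set_integrable lborel {0<..} (\<lambda>r. of_real r powr (a - 1) * exp (- p * of_real r) * cos (k * of_real (sqrt r)))"
    and "(LBINT r:{0<..}. of_real r powr (a - 1) * exp (- p * of_real r) * cos (k * of_real (sqrt r)))
          = Gamma a * p powr (- a) * hyp_1F1 a (1/2) (- (k\<^sup>2 / (4 * p)))"
proof -
  define c where "c = (\<lambda>n. (- (k\<^sup>2)) ^ n / fact (2 * n))"
  have ratio: "norm (c (Suc n)) = norm (c n) * ((norm k)\<^sup>2 / ((2 * n + 1) * (2 * n + 2)))" for n
  proof -
    have "c (Suc n) = c n * (- (k\<^sup>2) / of_nat ((2 * n + 1) * (2 * n + 2)))" by (simp add: c_def algebra_simps)
    also have "norm \<dots> = norm (c n) * ((norm k)\<^sup>2 / ((2 * n + 1) * (2 * n + 2)))"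
      by (simp only: norm_mult norm_divide norm_minus_cancel norm_of_nat norm_power)
    finally show ?thesis .
  qed
  have pt: "summable (\<lambda>n. norm (c n) * r ^ n)" for r :: real
  proof -
    have "summable (\<lambda>n. norm (c n) * \<bar>r\<bar> ^ n)"
    proof (rule summable_ratio_tendsto)
      show "norm (c (Suc n)) * \<bar>r\<bar> ^ Suc n \<le> \<bar>r\<bar> * (norm k)\<^sup>2 * (1 / ((2 * real n + 1) * (2 * real n + 2))) * (norm (c n) * \<bar>r\<bar> ^ n)" for n
        unfolding ratio by (simp add: field_simps)
      have "(\<lambda>n. 1 / ((2 * real n + 1) * (2 * real n + 2))) \<longlonglongrightarrow> 0" by real_asymp
      from tendsto_mult_left[OF this]
      show "(\<lambda>n. \<bar>r\<bar> * (norm k)\<^sup>2 * (1 / ((2 * real n + 1) * (2 * real n + 2)))) \<longlonglongrightarrow> \<bar>r\<bar> * (norm k)\<^sup>2 * 0" .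
    qed auto
    then have "summable (\<lambda>n. norm (norm (c n) * r ^ n))" by (simp add: abs_mult power_abs)
    then show ?thesis by (rule summable_norm_cancel)
  qed
  have sm: "summable (\<lambda>n. norm (c n) * Gamma (Re a + n) * Re p powr (- (Re a + n)))"
  proof (rule summable_ratio_tendsto)
    let ?q = "\<lambda>n. (norm k)\<^sup>2 / Re p * ((Re a + real n) / ((2 * real n + 1) * (2 * real n + 2)))"
    show "0 \<le> norm (c n) * Gamma (Re a + n) * Re p powr - (Re a + n)" for n
      using a by (intro mult_nonneg_nonneg) (auto intro: less_imp_le)
    show "norm (c (Suc n)) * Gamma (Re a + Suc n) * Re p powr - (Re a + Suc n)
        \<le> ?q n * (norm (c n) * Gamma (Re a + n) * Re p powr - (Re a + n))" for n
      using p a unfolding ratio by (subst Gamma_real_add_nat)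
          (auto simp: powr_diff powr_minus powr_add field_simps)
    have "(\<lambda>n. (Re a + real n) / ((2 * real n + 1) * (2 * real n + 2))) \<longlonglongrightarrow> 0" by real_asymp
    from tendsto_mult_left[OF this] show "?q \<longlonglongrightarrow> (norm k)\<^sup>2 / Re p * 0" .
  qed simp
  have cs: "(\<Sum>n. c n * of_real r ^ n) = cos (k * of_real (sqrt r))" if "r > 0" for r :: real
  proof -
    have "(k * of_real (sqrt r))\<^sup>2 = k\<^sup>2 * of_real r" using that
      by (simp add: power_mult_distrib flip: of_real_power)
    then have *: "- ((k * of_real (sqrt r))\<^sup>2) = (- (k\<^sup>2)) * of_real r" by simp
    have "(- ((k * of_real (sqrt r))\<^sup>2)) ^ n / fact (2 * n) = c n * of_real r ^ n" for n
      unfolding * unfolding power_mult_distrib c_def by simp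
    with cos_series_square[of "k * of_real (sqrt r)"] show ?thesis by (simp add: sums_iff)
  qed
  note * = laplace_termwise[OF a p pt sm]
  show "set_integrable lborel {0<..} (\<lambda>r. of_real r powr (a - 1) * exp (- p * of_real r) * cos (k * of_real (sqrt r)))"
    using *(1) by (rule set_integrable_cong[THEN iffD1, rotated 3]) (auto simp: cs)
  have "(LBINT r:{0<..}. of_real r powr (a - 1) * exp (- p * of_real r) * cos (k * of_real (sqrt r)))
    = (LBINT r:{0<..}. of_real r powr (a - 1) * exp (- p * of_real r) * (\<Sum>n. c n * of_real r ^ n))"
    by (rule set_lebesgue_integral_cong) (auto simp: cs)
  also note *(2)
  also have "(\<Sum>n. c n * pochhammer a n / p ^ n) = hyp_1F1 a (1/2) (- (k\<^sup>2 / (4 * p)))"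
    unfolding hyp_1F1_def
  proof (rule suminf_cong)
    fix n
    have "(- (k\<^sup>2 / (4 * p))) ^ n = (- (k\<^sup>2)) ^ n / (4 ^ n * p ^ n)"
      unfolding minus_divide_left power_divide power_mult_distrib ..
    then show "c n * pochhammer a n / p ^ n = pochhammer a n * (- (k\<^sup>2 / (4 * p))) ^ n / (pochhammer (1 / 2) n * fact n)"
      unfolding c_def fact_double_pochhammer by (simp add: field_simps)
  qed
  finally show "(LBINT r:{0<..}. of_real r powr (a - 1) * exp (- p * of_real r) * cos (k * of_real (sqrt r)))
          = Gamma a * p powr (- a) * hyp_1F1 a (1/2) (- (k\<^sup>2 / (4 * p)))" .
qed

lemma norm_pochhammer_Suc_ge:
  fixes a :: complex
  assumes "Re a > 0"
  shows "norm (pochhammer a (Suc n)) \<ge> norm (pochhammer a n) * (Re a + n)"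
proof -
  have "Re a + n \<le> norm (a + of_nat n)" using complex_Re_le_cmod[of "a + of_nat n"] by simp
  then show ?thesis unfolding pochhammer_Suc norm_mult by (intro mult_left_mono) auto
qed

lemma pochhammer_nonzero:
  fixes a :: complex
  assumes "Re a > 0"
  shows "pochhammer a n \<noteq> 0"
proof
  assume "pochhammer a n = 0"
  then obtain k where "a = - of_nat k" by (auto simp: pochhammer_eq_0_iff)
  then show False using assms by simp
qed

lemma norm_0F2_coeff_Suc:
  fixes a b u :: complex
  assumes "Re a > 0" "Re b > 0"
  shows "norm (u ^ Suc n / (pochhammer a (Suc n) * pochhammer b (Suc n) * fact (Suc n))) \<le>
     norm u / ((Re a + n) * (Re b + n) * (real n + 1)) * norm (u ^ n / (pochhammer a n * pochhammer b n * fact n))"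
proof -
  have pos: "norm (pochhammer a n) * (Re a + n) > 0" "norm (pochhammer b n) * (Re b + n) > 0"
    using pochhammer_nonzero assms by auto
  have "(norm (pochhammer a n) * (Re a + n)) * (norm (pochhammer b n) * (Re b + n)) * fact (Suc n) \<le>
     norm (pochhammer a (Suc n)) * norm (pochhammer b (Suc n)) * fact (Suc n)"
    using pos by (intro mult_mono norm_pochhammer_Suc_ge assms) auto
  then have "norm u ^ Suc n / (norm (pochhammer a (Suc n)) * norm (pochhammer b (Suc n)) * fact (Suc n)) \<le>
    norm u ^ Suc n / ((norm (pochhammer a n) * (Re a + n)) * (norm (pochhammer b n) * (Re b + n)) * fact (Suc n))"
    using pos by (intro divide_left_mono mult_pos_pos) (auto simp: pochhammer_nonzero assms add_pos_nonneg)
  then show ?thesis unfolding norm_divide norm_mult norm_power norm_fact by (simp add: mult_ac add_ac)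
qed

text \<open>After rescaling \<open>u\<close> by \<open>e\<^sup>2\<close>, the coefficients are compared with \<open>1 / (2n)!\<close>, those of
\<open>cosh (sqrt u)\<close>: as three factorial-like factors stand against \<open>(2n)!\<close>, the quotients have consecutive
ratios of order \<open>1 / n\<close> and therefore stay bounded, however small \<open>e\<close> is.\<close>
lemma hyp_0F2_bound:
  fixes a b :: complex and e :: real
  assumes ab: "Re a > 0" "Re b > 0" and e: "e > 0"
  shows "\<exists>C\<ge>0. \<forall>u. norm (hyp_0F2 a b u) \<le> C * exp (e * sqrt (norm u))"
proof -
  \<comment> \<open>The quotient of the \<open>n\<close>-th coefficient of \<open>0F2\<close> by \<open>e^(2n) / (2n)!\<close>.\<close>
  define d where "d = (\<lambda>n. norm ((1 / of_real (e\<^sup>2)) ^ n / (pochhammer a n * pochhammer b n * fact n)) * fact (2 * n))"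
  have "summable d"
  proof (rule summable_ratio_tendsto)
    show "d n \<ge> 0" for n by (simp add: d_def)
    let ?q = "\<lambda>n. 1 / e\<^sup>2 * ((2 * real n + 1) * (2 * real n + 2) / ((Re a + n) * (Re b + n) * (real n + 1)))"
    show "d (Suc n) \<le> ?q n * d n" for n
    proof -
      have "d (Suc n) \<le> norm (1 / of_real (e\<^sup>2) :: complex) / ((Re a + n) * (Re b + n) * (real n + 1)) * 
          norm ((1 / of_real (e\<^sup>2)) ^ n / (pochhammer a n * pochhammer b n * fact n)) * fact (2 * Suc n)"
        unfolding d_def by (intro mult_right_mono norm_0F2_coeff_Suc ab) simp
      also have "\<dots> = ?q n * d n"
        unfolding d_def by (simp add: norm_divide norm_power field_simps)
      finally show ?thesis .
    qed
    have "(\<lambda>n. (2 * real n + 1) * (2 * real n + 2) / ((Re a + n) * (Re b + n) * (real n + 1))) \<longlonglongrightarrow> 0"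
      by real_asymp
    from tendsto_mult_left[OF this] show "?q \<longlonglongrightarrow> 1 / e\<^sup>2 * 0" .
  qed simp
  then have "Bseq d" by (intro convergent_imp_Bseq convergentI) (rule summable_LIMSEQ_zero)
  then obtain C where C: "C > 0" "\<And>n. norm (d n) \<le> C" by (auto elim: BseqE)
  show ?thesis
  proof (intro exI[of _ C] conjI allI)
    fix u :: complex
    define v where "v = e * sqrt (norm u)"
    have v: "v \<ge> 0" using e by (simp add: v_def)
    have cosh: "(\<lambda>n. v ^ (2 * n) / fact (2 * n)) sums cosh v"
    proof -
      have "strict_mono (\<lambda>n::nat. 2 * n)" by (simp add: strict_mono_def)
      moreover have "(if even n then v ^ n /\<^sub>R fact n else 0) = 0" if "n \<notin> range (\<lambda>n. 2 * n)" for n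
        using that by (auto elim!: evenE)
      ultimately show ?thesis
        using cosh_converges[of v] sums_mono_reindex[of "\<lambda>n::nat. 2 * n" "\<lambda>n. if even n then v ^ n /\<^sub>R fact n else 0"] 
        by (simp add: field_simps)
    qed
    have le: "norm (u ^ n / (pochhammer a n * pochhammer b n * fact n)) \<le> C * (v ^ (2 * n) / fact (2 * n))" for n
    proof -
      have "norm (u ^ n / (pochhammer a n * pochhammer b n * fact n)) = d n * (v ^ (2 * n) / fact (2 * n))"
      proof -
        have "v ^ (2 * n) = (e\<^sup>2) ^ n * norm u ^ n"
          unfolding power_mult v_def by (simp add: power_mult_distrib)
        moreover have "d n = (1 / e\<^sup>2) ^ n * fact (2 * n) / norm (pochhammer a n * pochhammer b n * fact n)"
          by (simp add: d_def norm_divide norm_power)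
        ultimately have "d n * (v ^ (2 * n) / fact (2 * n)) =
            ((1 / e\<^sup>2) ^ n * (e\<^sup>2) ^ n) * norm u ^ n / norm (pochhammer a n * pochhammer b n * fact n)"
          by simp
        also have "(1 / e\<^sup>2) ^ n * (e\<^sup>2) ^ n = 1"
          using e by (simp flip: power_mult_distrib)
        finally show ?thesis by (simp only: norm_divide norm_power mult_1)
      qed
      also have "\<dots> \<le> C * (v ^ (2 * n) / fact (2 * n))"
        using C(2)[of n] v by (intro mult_right_mono) auto
      finally show ?thesis .
    qed
    have s: "summable (\<lambda>n. C * (v ^ (2 * n) / fact (2 * n)))" using cosh by (intro summable_mult) (simp add: sums_iff)
    have sn: "summable (\<lambda>n. norm (u ^ n / (pochhammer a n * pochhammer b n * fact n)))"
      by (rule summable_comparison_test'[OF s]) (use le in auto)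
    have "norm (hyp_0F2 a b u) \<le> (\<Sum>n. norm (u ^ n / (pochhammer a n * pochhammer b n * fact n)))"
      unfolding hyp_0F2_def by (rule summable_norm[OF sn])
    also have "\<dots> \<le> (\<Sum>n. C * (v ^ (2 * n) / fact (2 * n)))" by (rule suminf_le[OF le sn s])
    also have "\<dots> = C * cosh v" using cosh by (subst suminf_mult) (auto simp: sums_iff)
    also have "\<dots> \<le> C * exp v" using C v by (intro mult_left_mono) (auto simp: cosh_def)
    finally show "norm (hyp_0F2 a b u) \<le> C * exp (e * sqrt (norm u))" by (simp add: v_def)
  qed (use C in simp)
qed

text \<open>The factor \<open>Gamma (b + n)\<close> from the Laplace transform cancels the parameter \<open>b\<close> of \<open>0F2\<close>, leaving
\<open>0F1 (1/2)\<close>, which is a cosine of a square root.\<close>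
lemma laplace_hyp_0F2:
  fixes b \<beta> k :: complex and t :: real
  assumes b: "Re b > 0" and t: "t > 0" and k: "k\<^sup>2 = 4 * \<beta>"
  shows "(LBINT y:{0<..}. of_real y powr (b - 1) * exp (- of_real t * of_real y) * hyp_0F2 (1/2) b (- (\<beta> * of_real y)))
          = Gamma b * of_real t powr (- b) * cos (k / of_real (sqrt t))"
proof -
  define c where "c = (\<lambda>n. (- \<beta>) ^ n / (pochhammer (1/2) n * pochhammer b n * fact n))"
  have ratio: "norm (c (Suc n)) \<le> norm \<beta> / ((1/2 + n) * (Re b + n) * (real n + 1)) * norm (c n)" for n
    using norm_0F2_coeff_Suc[of "1/2" b "-\<beta>" n] b by (simp add: c_def)
  have pt: "summable (\<lambda>n. norm (c n) * r ^ n)" for r :: real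
  proof -
    have "summable (\<lambda>n. norm (c n) * \<bar>r\<bar> ^ n)"
    proof (rule summable_ratio_tendsto)
      show "norm (c (Suc n)) * \<bar>r\<bar> ^ Suc n \<le> \<bar>r\<bar> * norm \<beta> * (1 / ((1/2 + real n) * (Re b + n) * (real n + 1))) * (norm (c n) * \<bar>r\<bar> ^ n)" for n
        using mult_right_mono[OF ratio, of "\<bar>r\<bar> ^ Suc n" n] by (simp add: mult_ac)
      have "(\<lambda>n. 1 / ((1/2 + real n) * (Re b + n) * (real n + 1))) \<longlonglongrightarrow> 0" by real_asymp
      from tendsto_mult_left[OF this]
      show "(\<lambda>n. \<bar>r\<bar> * norm \<beta> * (1 / ((1/2 + real n) * (Re b + n) * (real n + 1)))) \<longlonglongrightarrow> \<bar>r\<bar> * norm \<beta> * 0" .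
    qed auto
    then have "summable (\<lambda>n. norm (norm (c n) * r ^ n))" by (simp add: abs_mult power_abs)
    then show ?thesis by (rule summable_norm_cancel)
  qed
  have sm: "summable (\<lambda>n. norm (c n) * Gamma (Re b + n) * Re (of_real t) powr (- (Re b + n)))"
  proof (rule summable_ratio_tendsto)
    let ?q = "\<lambda>n. norm \<beta> / t * (1 / ((1/2 + real n) * (real n + 1)))"
    show G: "0 \<le> norm (c n) * Gamma (Re b + n) * Re (of_real t) powr - (Re b + n)" for n
      using b by (intro mult_nonneg_nonneg) (auto intro: less_imp_le)
    show "norm (c (Suc n)) * Gamma (Re b + Suc n) * Re (of_real t) powr - (Re b + Suc n)
        \<le> ?q n * (norm (c n) * Gamma (Re b + n) * Re (of_real t) powr - (Re b + n))" for n
    proof -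
      have "norm (c (Suc n)) * Gamma (Re b + Suc n) * Re (of_real t) powr - (Re b + Suc n) \<le>
        norm \<beta> / ((1/2 + n) * (Re b + n) * (real n + 1)) * norm (c n) * Gamma (Re b + Suc n) * Re (of_real t) powr - (Re b + Suc n)"
        using b by (intro mult_right_mono ratio) (auto intro!: less_imp_le)
      also have "\<dots> = ?q n * (norm (c n) * Gamma (Re b + n) * Re (of_real t) powr - (Re b + n))"
        using t b by (subst Gamma_real_add_nat) (auto simp: powr_diff powr_minus powr_add divide_simps)
      finally show ?thesis .
    qed
    have "(\<lambda>n. 1 / ((1/2 + real n) * (real n + 1))) \<longlonglongrightarrow> 0" by real_asymp
    from tendsto_mult_left[OF this] show "?q \<longlonglongrightarrow> norm \<beta> / t * 0" .
  qed simp
  have cs: "(\<Sum>n. c n * of_real y ^ n) = hyp_0F2 (1/2) b (- (\<beta> * of_real y))" for y :: real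
    unfolding hyp_0F2_def c_def mult_minus_left[symmetric] power_mult_distrib by simp
  have "(LBINT y:{0<..}. of_real y powr (b - 1) * exp (- of_real t * of_real y) * hyp_0F2 (1/2) b (- (\<beta> * of_real y)))
    = Gamma b * of_real t powr (- b) * (\<Sum>n. c n * pochhammer b n / of_real t ^ n)"
    using laplace_termwise(2)[OF b _ pt sm] t by (simp add: cs)
  also have "(\<Sum>n. c n * pochhammer b n / of_real t ^ n) = (\<Sum>n. (- ((k / of_real (sqrt t))\<^sup>2)) ^ n / fact (2 * n))"
  proof (rule suminf_cong)
    fix n
    have "(k / of_real (sqrt t))\<^sup>2 = 4 * \<beta> / of_real t"
      using t by (simp add: power_divide k flip: of_real_power)
    then have *: "- ((k / of_real (sqrt t))\<^sup>2) = (4 * (- \<beta>)) / of_real t" by simp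
    have eq: "(- ((k / of_real (sqrt t))\<^sup>2)) ^ n = 4 ^ n * (- \<beta>) ^ n / of_real t ^ n"
      unfolding * unfolding power_divide power_mult_distrib ..
    show "c n * pochhammer b n / of_real t ^ n = (- ((k / of_real (sqrt t))\<^sup>2)) ^ n / fact (2 * n)"
      unfolding eq c_def fact_double_pochhammer using pochhammer_nonzero[OF b] by (simp add: field_simps)
  qed
  also have "\<dots> = cos (k / of_real (sqrt t))"
    using cos_series_square[of "k / of_real (sqrt t)"] by (simp add: sums_iff)
  finally show ?thesis .
qed

section \<open>The exponential of a product of square roots as an integral\<close>

lemma integral_FTC_half_line:
  fixes f F :: "real \<Rightarrow> complex"
  assumes F: "\<And>x. x > 0 \<Longrightarrow> (F has_vector_derivative f x) (at x)"
    and f: "\<And>x. x > 0 \<Longrightarrow> isCont f x"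
    and int: "set_integrable lborel {0<..} f"
    and A: "(F \<longlongrightarrow> A) (at_right 0)" and B: "(F \<longlongrightarrow> B) at_top"
  shows "(LBINT x:{0<..}. f x) = B - A"
proof -
  have e: "einterval (ereal 0) \<infinity> = {0<..}" by (auto simp: einterval_def)
  have "(LBINT x=ereal 0..\<infinity>. f x) = B - A"
    by (rule interval_integral_FTC_integrable[where F = F])
      (use assms in \<open>auto simp: e ereal_tendsto_simps\<close>)
  then show ?thesis by (simp add: interval_lebesgue_integral_def e)
qed

lemma gauss_primitive_limit:
  fixes P :: "complex \<Rightarrow> complex"
  assumes P: "\<And>z. (P has_field_derivative exp (- (z\<^sup>2))) (at z)"
  shows "((\<lambda>r::real. P (of_real r)) \<longlongrightarrow> P 0 + of_real (sqrt pi / 2)) at_top"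
proof -
  let ?f = "\<lambda>x::real. of_real (indicator {0..} x *\<^sub>R exp (- x\<^sup>2)) :: complex"
  have 0: "has_bochner_integral lborel ?f (of_real (sqrt pi / 2))"
    using gaussian_moment_0 by (rule has_bochner_integral_of_real)
  then have "((\<lambda>y. LBINT x. indicator {..y} x *\<^sub>R ?f x) \<longlongrightarrow> (LBINT x. ?f x)) at_top"
    by (intro tendsto_integral_at_top) (auto intro: integrable.intros)
  also have "(LBINT x. ?f x) = of_real (sqrt pi / 2)"
    using 0 by (simp only: has_bochner_integral_integral_eq)
  finally have 1: "((\<lambda>y. LBINT x. indicator {..y} x *\<^sub>R ?f x) \<longlongrightarrow> of_real (sqrt pi / 2)) at_top" .
  have 2: "(LBINT x. indicator {..y} x *\<^sub>R ?f x) = P (of_real y) - P 0" if "y \<ge> 0" for y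
  proof -
    have "(LBINT x. indicator {..y} x *\<^sub>R ?f x) = (LBINT x. indicator {0..y} x *\<^sub>R exp (- (of_real x)\<^sup>2) :: complex)"
      by (intro Bochner_Integration.integral_cong) (auto simp: indicator_def exp_of_real simp flip: of_real_power of_real_minus)
    also have "\<dots> = P (of_real y) - P (of_real 0)"
    proof (rule integral_FTC_Icc[OF that])
      fix x :: real
      have "((\<lambda>x::real. P (of_real x)) has_vector_derivative exp (- ((of_real x)\<^sup>2))) (at x)"
        using P[of "of_real x"] by (rule has_vector_derivative_real_field)
      then show "((\<lambda>x::real. P (of_real x)) has_vector_derivative exp (- (of_real x)\<^sup>2)) (at x within {0..y})"
        by (rule has_vector_derivative_at_within)
    qed (intro continuous_intros)
    finally show ?thesis by simp
  qed
  have "((\<lambda>y. P (of_real y) - P 0) \<longlongrightarrow> of_real (sqrt pi / 2)) at_top"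
    using 1 by (rule Lim_transform_eventually)
      (use 2 in \<open>auto intro: eventually_mono[OF eventually_ge_at_top[of 0]]\<close>)
  from tendsto_add[OF this tendsto_const[of "P 0"]] show ?thesis by (simp add: add_ac)
qed

text \<open>On the vertical segment from \<open>Re u\<close> to \<open>u\<close> the modulus of \<open>exp (- z\<^sup>2)\<close> is largest at \<open>u\<close>. This
transfers the limit of the error function from the real axis to curves on which \<open>Re (u\<^sup>2)\<close> tends
to infinity.\<close>
lemma gauss_primitive_dist_Re:
  fixes P :: "complex \<Rightarrow> complex"
  assumes P: "\<And>z. (P has_field_derivative exp (- (z\<^sup>2))) (at z)"
  shows "norm (P u - P (of_real (Re u))) \<le> norm u * exp (- Re (u\<^sup>2))"
proof -
  have b: "norm (exp (- (z\<^sup>2))) \<le> exp (- Re (u\<^sup>2))" if "z \<in> closed_segment (of_real (Re u)) u" for z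
  proof -
    from that obtain t where t: "0 \<le> t" "t \<le> 1" "z = (1 - t) *\<^sub>R of_real (Re u) + t *\<^sub>R u"
      by (auto simp: closed_segment_def)
    have "Re z = Re u" "Im z = t * Im u" by (simp_all add: t(3) algebra_simps)
    moreover have "(t * Im u)\<^sup>2 \<le> (Im u)\<^sup>2"
      using t by (simp add: power_mult_distrib mult_left_le_one_le power_le_one)
    ultimately show ?thesis by (simp add: power2_eq_square)
  qed
  have "norm (P u - P (of_real (Re u))) \<le> exp (- Re (u\<^sup>2)) * norm (u - of_real (Re u))"
    by (rule field_differentiable_bound[of "closed_segment (of_real (Re u)) u" P "\<lambda>z. exp (- (z\<^sup>2))"])
      (use P b in \<open>auto intro: has_field_derivative_at_within\<close>)
  also have "u - of_real (Re u) = \<i> * of_real (Im u)" by (simp add: complex_eq_iff)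
  also have "exp (- Re (u\<^sup>2)) * norm (\<i> * of_real (Im u)) \<le> exp (- Re (u\<^sup>2)) * norm u"
    by (intro mult_left_mono) (auto simp: norm_mult abs_Im_le_cmod)
  finally show ?thesis by (simp add: mult.commute)
qed

lemma gauss_primitive_limit_along:
  fixes P :: "complex \<Rightarrow> complex"
  assumes P: "\<And>z. (P has_field_derivative exp (- (z\<^sup>2))) (at z)"
    and inf: "filterlim (\<lambda>t. Re (u t)) at_top F"
    and err: "((\<lambda>t. norm (u t) * exp (- Re ((u t)\<^sup>2))) \<longlongrightarrow> 0) F"
  shows "((\<lambda>t. P (u t)) \<longlongrightarrow> P 0 + of_real (sqrt pi / 2)) F"
proof -
  have "((\<lambda>t. P (u t) - P (of_real (Re (u t)))) \<longlongrightarrow> 0) F"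
    by (rule Lim_null_comparison[OF _ err]) (intro always_eventually allI gauss_primitive_dist_Re P)
  from tendsto_add[OF this filterlim_compose[OF gauss_primitive_limit[OF P] inf]]
  show ?thesis by simp
qed

text \<open>With \<open>P\<close> a primitive of \<open>exp (- z\<^sup>2)\<close> and \<open>up\<close>, \<open>um\<close> standing for \<open>b sqrt t \<plusminus> a / sqrt t\<close>, the
function \<open>exp (2ab) P(up) + exp (- 2ab) P(um)\<close> is an antiderivative of \<open>b\<close> times the integrand: both squares
equal \<open>b\<^sup>2 t + a\<^sup>2 / t \<plusminus> 2ab\<close>, so the two Gaussians agree up to a constant and the terms in \<open>a / t\<close>
cancel. Towards 0 the curve \<open>um\<close> leaves to the left and \<open>up\<close> to the right, so that only the
terms with \<open>exp (- 2ab)\<close> survive in the difference of the limits.\<close>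
lemma bessel_half_integral:
  fixes a b :: complex
  assumes a: "Re a > 0" "Re (a\<^sup>2) > 0" and b: "Re b > 0" "Re (b\<^sup>2) > 0"
  shows "(LBINT t:{0<..}. exp (- b\<^sup>2 * of_real t - a\<^sup>2 / of_real t) / of_real (sqrt t)) =
     of_real (sqrt pi) / b * exp (- 2 * a * b)"
proof -
  obtain P :: "complex \<Rightarrow> complex" where P: "\<And>z. (P has_field_derivative exp (- (z\<^sup>2))) (at z)"
  proof -
    have "(\<lambda>z::complex. exp (- (z\<^sup>2))) holomorphic_on UNIV" by (intro holomorphic_intros)
    from holomorphic_convex_primitive'[OF convex_UNIV open_UNIV this] that show ?thesis by auto
  qed
  define up um where "up = (\<lambda>t. b * of_real (sqrt t) + a / of_real (sqrt t))"
    and "um = (\<lambda>t. b * of_real (sqrt t) - a / of_real (sqrt t))"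
  define F where "F = (\<lambda>t::real. exp (2 * a * b) * P (up t) + exp (- 2 * a * b) * P (um t))"
  define f where "f = (\<lambda>t::real. b * (exp (- b\<^sup>2 * of_real t - a\<^sup>2 / of_real t) / of_real (sqrt t)))"
  have sq: "(up t)\<^sup>2 = b\<^sup>2 * of_real t + a\<^sup>2 / of_real t + 2 * a * b"
           "(um t)\<^sup>2 = b\<^sup>2 * of_real t + a\<^sup>2 / of_real t - 2 * a * b" if "t > 0" for t
  proof -
    have s: "of_real (sqrt t) * of_real (sqrt t) = (of_real t :: complex)"
      using that by (simp flip: of_real_mult)
    have s': "of_real (sqrt t) \<noteq> (0::complex)" using that by simp
    show "(up t)\<^sup>2 = b\<^sup>2 * of_real t + a\<^sup>2 / of_real t + 2 * a * b"
      unfolding up_def s[symmetric] using s' by (simp add: power2_eq_square field_simps)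
    show "(um t)\<^sup>2 = b\<^sup>2 * of_real t + a\<^sup>2 / of_real t - 2 * a * b"
      unfolding um_def s[symmetric] using s' by (simp add: power2_eq_square field_simps)
  qed
  have deriv: "(F has_vector_derivative f t) (at t)" if t: "t > 0" for t
  proof -
    define s where "s = (of_real (sqrt t) :: complex)"
    have s: "s * s = of_real t" "s \<noteq> 0" using t by (auto simp: s_def simp flip: of_real_mult)
    have d: "((\<lambda>t. of_real (sqrt t) :: complex) has_vector_derivative of_real (inverse (sqrt t) / 2)) (at t)"
      using t by (intro has_vector_derivative_of_real) (auto intro!: derivative_eq_intros)
    have di: "((\<lambda>t. of_real (inverse (sqrt t)) :: complex) has_vector_derivative of_real (- (inverse (sqrt t) / (2 * t)))) (at t)"
      using t by (intro has_vector_derivative_of_real) (auto intro!: derivative_eq_intros simp: field_simps)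
    have "(up has_vector_derivative b * of_real (inverse (sqrt t) / 2) + a * of_real (- (inverse (sqrt t) / (2 * t)))) (at t)"
    proof -
      have "up = (\<lambda>t. b * of_real (sqrt t) + a * of_real (inverse (sqrt t)))"
        by (simp add: up_def fun_eq_iff divide_inverse)
      then show ?thesis
        by (simp only:) (intro has_vector_derivative_add has_vector_derivative_mult_right d di)
    qed
    also have "b * of_real (inverse (sqrt t) / 2) + a * of_real (- (inverse (sqrt t) / (2 * t))) = (b - a / of_real t) / (2 * s)"
      unfolding of_real_minus of_real_divide of_real_inverse of_real_mult of_real_numeral s_def[symmetric]
      using s(2) t by (simp add: field_simps)
    finally have dup: "(up has_vector_derivative (b - a / of_real t) / (2 * s)) (at t)" .
    have "(um has_vector_derivative b * of_real (inverse (sqrt t) / 2) - a * of_real (- (inverse (sqrt t) / (2 * t)))) (at t)"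
    proof -
      have "um = (\<lambda>t. b * of_real (sqrt t) - a * of_real (inverse (sqrt t)))"
        by (simp add: um_def fun_eq_iff divide_inverse)
      then show ?thesis
        by (simp only:) (intro has_vector_derivative_diff has_vector_derivative_mult_right d di)
    qed
    also have "b * of_real (inverse (sqrt t) / 2) - a * of_real (- (inverse (sqrt t) / (2 * t))) = (b + a / of_real t) / (2 * s)"
      unfolding of_real_minus of_real_divide of_real_inverse of_real_mult of_real_numeral s_def[symmetric]
      using s(2) t by (simp add: field_simps)
    finally have dum: "(um has_vector_derivative (b + a / of_real t) / (2 * s)) (at t)" .
    have "((P \<circ> up) has_vector_derivative (b - a / of_real t) / (2 * s) * exp (- ((up t)\<^sup>2))) (at t)"
      by (rule field_vector_diff_chain_at[OF dup P])
    moreover have "((P \<circ> um) has_vector_derivative (b + a / of_real t) / (2 * s) * exp (- ((um t)\<^sup>2))) (at t)"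
      by (rule field_vector_diff_chain_at[OF dum P])
    ultimately have "(F has_vector_derivative exp (2 * a * b) * ((b - a / of_real t) / (2 * s) * exp (- ((up t)\<^sup>2))) + 
      exp (- 2 * a * b) * ((b + a / of_real t) / (2 * s) * exp (- ((um t)\<^sup>2)))) (at t)"
      unfolding F_def o_def by (intro has_vector_derivative_add has_vector_derivative_mult_right)
    also have "exp (2 * a * b) * ((b - a / of_real t) / (2 * s) * exp (- ((up t)\<^sup>2))) + 
      exp (- 2 * a * b) * ((b + a / of_real t) / (2 * s) * exp (- ((um t)\<^sup>2)))
       = ((b - a / of_real t) / (2 * s)) * (exp (2 * a * b) * exp (- ((up t)\<^sup>2))) + 
         ((b + a / of_real t) / (2 * s)) * (exp (- 2 * a * b) * exp (- ((um t)\<^sup>2)))"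
      by (simp only: mult_ac)
    also have "exp (2 * a * b) * exp (- ((up t)\<^sup>2)) = exp (- b\<^sup>2 * of_real t - a\<^sup>2 / of_real t)"
      unfolding sq[OF t] exp_add[symmetric] by (simp add: algebra_simps)
    also have "exp (- 2 * a * b) * exp (- ((um t)\<^sup>2)) = exp (- b\<^sup>2 * of_real t - a\<^sup>2 / of_real t)"
      unfolding sq[OF t] exp_add[symmetric] by (simp add: algebra_simps)
    also have "((b - a / of_real t) / (2 * s)) * exp (- b\<^sup>2 * of_real t - a\<^sup>2 / of_real t) + 
       ((b + a / of_real t) / (2 * s)) * exp (- b\<^sup>2 * of_real t - a\<^sup>2 / of_real t) = f t"
      unfolding f_def s_def[symmetric] using s(2) t by (simp add: field_simps)
    finally show ?thesis .
  qed
  have cont: "isCont f t" if "t > 0" for t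
    unfolding f_def using that by (intro continuous_intros) auto
  have int0: "set_integrable lborel {0<..} (\<lambda>t. exp (- b\<^sup>2 * of_real t - a\<^sup>2 / of_real t) / of_real (sqrt t))"
  proof (rule set_integrable_bound[OF set_integrable_powr_exp[of "1/2" "Re (b\<^sup>2)"]])
    have "norm (exp (- b\<^sup>2 * of_real t - a\<^sup>2 / of_real t) / of_real (sqrt t)) \<le> t powr (1/2 - 1) * exp (- Re (b\<^sup>2) * t)"
      if t: "t > 0" for t
    proof -
      have "norm (exp (- b\<^sup>2 * of_real t - a\<^sup>2 / of_real t) / of_real (sqrt t)) = exp (- Re (b\<^sup>2) * t - Re (a\<^sup>2) / t) / sqrt t"
        using t by (simp add: norm_divide)
      also have "\<dots> \<le> exp (- Re (b\<^sup>2) * t) / sqrt t"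
        using t a(2) by (intro divide_right_mono) auto
      also have "\<dots> = t powr (1/2 - 1) * exp (- Re (b\<^sup>2) * t)"
        using t by (simp add: powr_minus powr_half_sqrt field_simps)
      finally show ?thesis .
    qed
    then show "AE t in lborel. t \<in> {0<..} \<longrightarrow> norm (exp (- b\<^sup>2 * of_real t - a\<^sup>2 / of_real t) / of_real (sqrt t)) \<le>
        norm (t powr (1/2 - 1) * exp (- Re (b\<^sup>2) * t))"
      by (intro AE_I2 impI) auto
    show "set_borel_measurable lborel {0<..} (\<lambda>t. exp (- b\<^sup>2 * of_real t - a\<^sup>2 / of_real t) / of_real (sqrt t))"
      unfolding set_borel_measurable_def by measurable
  qed (use b in auto)
  then have int: "set_integrable lborel {0<..} f" unfolding f_def by (rule set_integrable_mult_right)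
  define E where "E = (\<lambda>t. (norm b * sqrt t + norm a / sqrt t) * exp (2 * norm (a * b)) * exp (- Re (b\<^sup>2) * t - Re (a\<^sup>2) / t))"
  have E0: "(E \<longlongrightarrow> 0) (at_right 0)" "(E \<longlongrightarrow> 0) at_top"
    unfolding E_def using a(2) b(2) by real_asymp+
  have err: "norm (up t) * exp (- Re ((up t)\<^sup>2)) \<le> E t" "norm (um t) * exp (- Re ((um t)\<^sup>2)) \<le> E t" if t: "t > 0" for t
  proof -
    have n: "norm (b * of_real (sqrt t)) = norm b * sqrt t" "norm (a / of_real (sqrt t)) = norm a / sqrt t"
      using t by (auto simp: norm_mult norm_divide)
    have ab: "\<bar>Re (a * b)\<bar> \<le> norm (a * b)" by (rule abs_Re_le_cmod)
    have n0: "0 \<le> norm b * sqrt t + norm a / sqrt t" using t by simp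
    have r: "Re (b\<^sup>2 * of_real t + a\<^sup>2 / of_real t + 2 * a * b) = Re (b\<^sup>2) * t + Re (a\<^sup>2) / t + 2 * Re (a * b)"
      "Re (b\<^sup>2 * of_real t + a\<^sup>2 / of_real t - 2 * a * b) = Re (b\<^sup>2) * t + Re (a\<^sup>2) / t - 2 * Re (a * b)"
      by (simp_all add: algebra_simps)
    have "norm (up t) * exp (- Re ((up t)\<^sup>2)) \<le> (norm b * sqrt t + norm a / sqrt t) *
        exp (2 * norm (a * b) + (- Re (b\<^sup>2) * t - Re (a\<^sup>2) / t))"
      unfolding sq[OF t] r using ab norm_triangle_ineq[of "b * of_real (sqrt t)" "a / of_real (sqrt t)"] n n0
      by (intro mult_mono) (auto simp: up_def)
    then show "norm (up t) * exp (- Re ((up t)\<^sup>2)) \<le> E t" by (simp only: E_def exp_add mult.assoc)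
    have "norm (um t) * exp (- Re ((um t)\<^sup>2)) \<le> (norm b * sqrt t + norm a / sqrt t) *
        exp (2 * norm (a * b) + (- Re (b\<^sup>2) * t - Re (a\<^sup>2) / t))"
      unfolding sq[OF t] r using ab norm_triangle_ineq4[of "b * of_real (sqrt t)" "a / of_real (sqrt t)"] n n0
      by (intro mult_mono) (auto simp: um_def)
    then show "norm (um t) * exp (- Re ((um t)\<^sup>2)) \<le> E t" by (simp only: E_def exp_add mult.assoc)
  qed
  have errp: "((\<lambda>t. norm (up t) * exp (- Re ((up t)\<^sup>2))) \<longlongrightarrow> 0) G" 
   and errm: "((\<lambda>t. norm (um t) * exp (- Re ((um t)\<^sup>2))) \<longlongrightarrow> 0) G"
   and errm': "((\<lambda>t. norm (- um t) * exp (- Re ((- um t)\<^sup>2))) \<longlongrightarrow> 0) G"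
    if "eventually (\<lambda>t. t > 0) G" "(E \<longlongrightarrow> 0) G" for G
    by ((rule Lim_null_comparison[OF _ that(2)], rule eventually_mono[OF that(1)], use err in simp))+
  have pos: "eventually (\<lambda>t::real. t > 0) (at_right 0)" "eventually (\<lambda>t::real. t > 0) at_top"
    by (auto simp: eventually_at_right_less eventually_gt_at_top)
  have re: "filterlim (\<lambda>t. Re (up t)) at_top at_top" "filterlim (\<lambda>t. Re (up t)) at_top (at_right 0)"
     "filterlim (\<lambda>t. Re (um t)) at_top at_top" "filterlim (\<lambda>t. Re (- um t)) at_top (at_right 0)"
  proof -
    have *: "Re (up t) = Re b * sqrt t + Re a / sqrt t" "Re (um t) = Re b * sqrt t - Re a / sqrt t"
        "Re (- um t) = Re a / sqrt t - Re b * sqrt t" for t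
      by (auto simp: up_def um_def)
    show "filterlim (\<lambda>t. Re (up t)) at_top at_top" "filterlim (\<lambda>t. Re (up t)) at_top (at_right 0)"
     "filterlim (\<lambda>t. Re (um t)) at_top at_top" "filterlim (\<lambda>t. Re (- um t)) at_top (at_right 0)"
      unfolding * using a(1) b(1) by real_asymp+
  qed
  \<comment> \<open>The curve \<open>um\<close> tends to the left near 0, so the limit is taken for the reflected primitive \<open>- P (- z)\<close>.\<close>
  have dP': "((\<lambda>z. - P (- z)) has_field_derivative exp (- (z\<^sup>2))) (at z)" for z
    using P[of "- z"] by (auto intro!: derivative_eq_intros DERIV_chain2[of P])
  define L where "L = complex_of_real (sqrt pi / 2)"
  have m0: "((\<lambda>t. P (um t)) \<longlongrightarrow> P 0 - L) (at_right 0)"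
    using tendsto_minus[OF gauss_primitive_limit_along[OF dP' re(4) errm'[OF pos(1) E0(1)]]]
    by (simp add: L_def)
  have A: "(F \<longlongrightarrow> exp (2 * a * b) * (P 0 + L) + exp (- 2 * a * b) * (P 0 - L)) (at_right 0)"
    unfolding F_def using gauss_primitive_limit_along[OF P re(2) errp[OF pos(1) E0(1)]] m0
    by (intro tendsto_intros) (auto simp: L_def)
  have B: "(F \<longlongrightarrow> exp (2 * a * b) * (P 0 + L) + exp (- 2 * a * b) * (P 0 + L)) at_top"
    unfolding F_def using gauss_primitive_limit_along[OF P re(1) errp[OF pos(2) E0(2)]]
        gauss_primitive_limit_along[OF P re(3) errm[OF pos(2) E0(2)]]
    by (intro tendsto_intros) (auto simp: L_def)
  have "(LBINT t:{0<..}. f t) = 2 * L * exp (- 2 * a * b)"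
    using integral_FTC_half_line[OF deriv cont int A B] by (simp add: algebra_simps)
  then have "b * (LBINT t:{0<..}. exp (- b\<^sup>2 * of_real t - a\<^sup>2 / of_real t) / of_real (sqrt t)) = 2 * L * exp (- 2 * a * b)"
    unfolding f_def by (simp only: set_integral_mult_right)
  moreover have "b \<noteq> 0" using b by auto
  ultimately show ?thesis by (simp add: L_def field_simps)
qed

section \<open>Interchanging a Laplace integral with a parameter integral\<close>

text \<open>The growth of \<open>U\<close> is absorbed by half of the exponential: by the inequality of the arithmetic and
geometric mean, \<open>e sqrt y \<le> k t * y / 2 + e\<^sup>2 / (2 k t)\<close>. What remains in \<open>y\<close> is a Gamma integral, and
the loss \<open>exp (e\<^sup>2 / (2 k t))\<close> reappears in the hypothesis on \<open>g\<close>.\<close>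
lemma laplace_fubini:
  fixes g U :: "real \<Rightarrow> complex" and k :: "real \<Rightarrow> real" and b :: complex and C e :: real
  assumes [measurable]: "g \<in> borel_measurable borel" "k \<in> borel_measurable borel" "U \<in> borel_measurable borel"
    and k: "\<And>t. t > 0 \<Longrightarrow> k t > 0" and b: "Re b > 0"
    and U: "\<And>y. y > 0 \<Longrightarrow> norm (U y) \<le> C * exp (e * sqrt y)" and C: "C \<ge> 0"
    and int: "set_integrable lborel {0<..} (\<lambda>t. norm (g t) * k t powr (- Re b) * exp (e\<^sup>2 / (2 * k t)))"
  defines "H \<equiv> (\<lambda>t y. g t * (of_real y powr (b - 1) * exp (- of_real (k t) * of_real y) * U y))"
  shows "set_integrable lborel {0<..} (\<lambda>y. LBINT t:{0<..}. H t y)"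
    and "(LBINT y:{0<..}. LBINT t:{0<..}. H t y) = (LBINT t:{0<..}. LBINT y:{0<..}. H t y)"
proof -
  define D where "D = (\<lambda>t y. indicator {0<..} t *\<^sub>R (indicator {0<..} y *\<^sub>R
     ((norm (g t) * C * exp (e\<^sup>2 / (2 * k t))) * (y powr (Re b - 1) * exp (- (k t / 2) * y)))))"
  define H' where "H' = (\<lambda>t y. indicator {0<..} t *\<^sub>R (indicator {0<..} y *\<^sub>R H t y))"
  have Di: "(LBINT y. D t y) = indicator {0<..} t *\<^sub>R (C * Gamma (Re b) * 2 powr Re b * (norm (g t) * k t powr (- Re b) * exp (e\<^sup>2 / (2 * k t))))" 
    and Dint: "integrable lborel (D t)" for t
  proof -
    have "(LBINT y. D t y) = indicator {0<..} t *\<^sub>R ((norm (g t) * C * exp (e\<^sup>2 / (2 * k t))) * (LBINT y:{0<..}. y powr (Re b - 1) * exp (- (k t / 2) * y)))"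
    proof -
      have "D t = (\<lambda>y. (indicator {0<..} t * (norm (g t) * C * exp (e\<^sup>2 / (2 * k t)))) *
          (indicator {0<..} y *\<^sub>R (y powr (Re b - 1) * exp (- (k t / 2) * y))))"
        by (auto simp: D_def fun_eq_iff)
      then show ?thesis
        by (simp only: integral_mult_right_zero set_lebesgue_integral_def real_scaleR_def mult.assoc)
    qed
    also have "\<dots> = indicator {0<..} t *\<^sub>R ((norm (g t) * C * exp (e\<^sup>2 / (2 * k t))) * (Gamma (Re b) * (k t / 2) powr (- Re b)))"
    proof (cases "t > 0")
      case True
      then have "(LBINT y:{0<..}. y powr (Re b - 1) * exp (- (k t / 2) * y)) = Gamma (Re b) * (k t / 2) powr (- Re b)"
        using k b by (intro set_integral_powr_exp) auto
      then show ?thesis by (simp only:)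
    qed simp
    also have "\<dots> = indicator {0<..} t *\<^sub>R (C * Gamma (Re b) * 2 powr Re b * (norm (g t) * k t powr (- Re b) * exp (e\<^sup>2 / (2 * k t))))"
      using k[of t] by (cases "t > 0") (auto simp: powr_divide powr_minus field_simps)
    finally show "(LBINT y. D t y) = indicator {0<..} t *\<^sub>R (C * Gamma (Re b) * 2 powr Re b * (norm (g t) * k t powr (- Re b) * exp (e\<^sup>2 / (2 * k t))))" .
    show "integrable lborel (D t)"
    proof (cases "t > 0")
      case True
      have "integrable lborel (\<lambda>y. (norm (g t) * C * exp (e\<^sup>2 / (2 * k t))) * (indicator {0<..} y *\<^sub>R (y powr (Re b - 1) * exp (- (k t / 2) * y))))"
        using set_integrable_powr_exp[of "Re b" "k t / 2"] k[OF True] b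
        by (intro integrable_mult_right) (simp add: set_integrable_def)
      then show ?thesis using True by (simp add: D_def mult_ac)
    qed (simp add: D_def)
  qed
  have D0: "D t y \<ge> 0" for t y using C by (auto simp: D_def indicator_def)
  have "integrable (lborel \<Otimes>\<^sub>M lborel) (case_prod D)"
  proof (rule lborel_pair.Fubini_integrable)
    show "case_prod D \<in> borel_measurable (lborel \<Otimes>\<^sub>M lborel)"
      unfolding D_def by measurable
    have "integrable lborel (\<lambda>t. C * Gamma (Re b) * 2 powr Re b * (indicator {0<..} t *\<^sub>R (norm (g t) * k t powr (- Re b) * exp (e\<^sup>2 / (2 * k t)))))"
      using int by (intro integrable_mult_right) (simp add: set_integrable_def)
    then show "integrable lborel (\<lambda>t. LBINT y. norm (case (t, y) of (t, y) \<Rightarrow> D t y))"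
      using D0 by (simp add: Di mult_ac)
  qed (use Dint in simp)
  then have int_H: "integrable (lborel \<Otimes>\<^sub>M lborel) (case_prod H')"
  proof (rule Bochner_Integration.integrable_bound)
    show "case_prod H' \<in> borel_measurable (lborel \<Otimes>\<^sub>M lborel)"
      unfolding H'_def H_def by measurable
    have "norm (H' t y) \<le> D t y" for t y
    proof (cases "t > 0 \<and> y > 0")
      case True
      then have kt: "k t > 0" using k by simp
      have "0 \<le> (sqrt (k t) * sqrt y - e / sqrt (k t))\<^sup>2" by simp
      also have "\<dots> = k t * y - 2 * e * sqrt y + e\<^sup>2 / k t"
        using kt True by (simp add: power2_diff power_mult_distrib power_divide)
      finally have am_gm: "- (k t * y) + e * sqrt y \<le> e\<^sup>2 / (2 * k t) + - (k t / 2) * y" by (simp add: field_simps)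
      have "norm (H' t y) = norm (g t) * (y powr (Re b - 1)) * exp (- (k t * y)) * norm (U y)"
        using True by (simp add: H'_def H_def norm_mult norm_powr_real_powr)
      also have "\<dots> \<le> norm (g t) * (y powr (Re b - 1)) * exp (- (k t * y)) * (C * exp (e * sqrt y))"
        using True by (intro mult_left_mono U) auto
      also have "\<dots> = norm (g t) * (y powr (Re b - 1)) * C * exp (- (k t * y) + e * sqrt y)"
        by (simp only: exp_add mult_ac)
      also have "\<dots> \<le> norm (g t) * (y powr (Re b - 1)) * C * exp (e\<^sup>2 / (2 * k t) + - (k t / 2) * y)"
        using C am_gm by (intro mult_left_mono) auto
      also have "\<dots> = D t y"
        using True unfolding D_def exp_add by simp
      finally show ?thesis .
    qed (auto simp: H'_def D_def)
    then show "AE x in lborel \<Otimes>\<^sub>M lborel. norm (case_prod H' x) \<le> norm (case_prod D x)"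
      using D0 by (intro AE_I2) (auto split: prod.splits)
  qed
  have eq1: "(LBINT t. H' t y) = indicator {0<..} y *\<^sub>R (LBINT t:{0<..}. H t y)" for y
    by (cases "y > 0") (auto simp: H'_def set_lebesgue_integral_def)
  have eq2: "(LBINT y. H' t y) = indicator {0<..} t *\<^sub>R (LBINT y:{0<..}. H t y)" for t
    by (cases "t > 0") (auto simp: H'_def set_lebesgue_integral_def)
  show "set_integrable lborel {0<..} (\<lambda>y. LBINT t:{0<..}. H t y)"
    using lborel_pair.integrable_snd[OF int_H] unfolding eq1 set_integrable_def .
  show "(LBINT y:{0<..}. LBINT t:{0<..}. H t y) = (LBINT t:{0<..}. LBINT y:{0<..}. H t y)"
    using lborel_pair.Fubini_integral[OF int_H] unfolding eq1 eq2 by (simp add: set_lebesgue_integral_def)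
qed

section \<open>Fourier and Mellin inversion\<close>

text \<open>The characteristic function of the standard normal distribution, rescaled.\<close>
lemma gaussian_fourier:
  fixes s v :: real
  assumes s: "s > 0"
  shows "integrable lborel (\<lambda>x. iexp (x * v) * of_real (exp (- (s * x)\<^sup>2 / 2)))"
    and "(LBINT x. iexp (x * v) * of_real (exp (- (s * x)\<^sup>2 / 2))) = of_real (sqrt (2 * pi) / s * exp (- (v / s)\<^sup>2 / 2))"
proof -
  have "char std_normal_distribution (v / s) = of_real (exp (- (v / s)\<^sup>2 / 2))"
    by (simp add: char_std_normal_distribution)
  then have 1: "(LBINT x. std_normal_density x *\<^sub>R iexp (v / s * x)) = of_real (exp (- (v / s)\<^sup>2 / 2))"
    unfolding char_def by (subst (asm) integral_density) auto
  have "(LBINT x. std_normal_density x *\<^sub>R iexp (v / s * x)) =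
     \<bar>s\<bar> *\<^sub>R (LBINT x. std_normal_density (0 + s * x) *\<^sub>R iexp (v / s * (0 + s * x)))"
    using s by (intro lborel_integral_real_affine) auto
  also have "(\<lambda>x. std_normal_density (0 + s * x) *\<^sub>R iexp (v / s * (0 + s * x)))
     = (\<lambda>x. of_real (1 / sqrt (2 * pi)) * (iexp (x * v) * of_real (exp (- (s * x)\<^sup>2 / 2))))"
    using s by (intro ext) (simp add: std_normal_density_def scaleR_conv_of_real mult_ac)
  finally have 2: "of_real s * (of_real (1 / sqrt (2 * pi)) * (LBINT x. iexp (x * v) * of_real (exp (- (s * x)\<^sup>2 / 2)))) = of_real (exp (- (v / s)\<^sup>2 / 2))"
    using s unfolding 1 by (simp only: integral_mult_right_zero abs_of_pos scaleR_conv_of_real)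
  then show "(LBINT x. iexp (x * v) * of_real (exp (- (s * x)\<^sup>2 / 2))) = of_real (sqrt (2 * pi) / s * exp (- (v / s)\<^sup>2 / 2))"
    using s by (simp add: field_simps)
  have "integrable lborel (\<lambda>x. std_normal_density (0 + s * x))"
    using s by (intro lborel_integrable_real_affine) auto
  then have "integrable lborel (\<lambda>x. sqrt (2 * pi) * std_normal_density (0 + s * x))"
    by (rule integrable_mult_right)
  then show "integrable lborel (\<lambda>x. iexp (x * v) * of_real (exp (- (s * x)\<^sup>2 / 2)))"
    by (rule Bochner_Integration.integrable_bound) (auto simp: norm_mult std_normal_density_def)
qed

text \<open>Gaussian regularisation: damping the transform by \<open>exp (- (s \<eta>)\<^sup>2 / 2)\<close> amounts to averaging \<open>g\<close>
around \<open>y\<close> with a normal density of standard deviation \<open>s\<close>. Dominated convergence lets \<open>s\<close> tend to 0 on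
both sides.\<close>
lemma fourier_inversion:
  fixes g :: "real \<Rightarrow> complex"
  assumes int: "integrable lborel g" and cont: "\<And>x. isCont g x" and bd: "\<And>x. norm (g x) \<le> B"
    and gint: "integrable lborel (\<lambda>\<eta>. LBINT u. g u * iexp (\<eta> * u))"
  shows "(LBINT \<eta>. (LBINT u. g u * iexp (\<eta> * u)) * iexp (- (\<eta> * y))) = of_real (2 * pi) * g y"
proof -
  define gh where "gh = (\<lambda>\<eta>. LBINT u. g u * iexp (\<eta> * u))"
  note [measurable] = borel_measurable_integrable[OF int]
  have [measurable]: "gh \<in> borel_measurable borel" using borel_measurable_integrable[OF gint] by (simp add: gh_def)
  have ghint: "integrable lborel gh" using gint by (simp add: gh_def)
  have reg: "(LBINT \<eta>. gh \<eta> * iexp (- (\<eta> * y)) * of_real (exp (- (s * \<eta>)\<^sup>2 / 2))) = 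
      of_real (2 * pi) * (LBINT x. of_real (std_normal_density x) * g (y + s * x))" if s: "s > 0" for s
  proof -
    define H where "H = (\<lambda>\<eta> u. g u * (iexp (\<eta> * (u - y)) * of_real (exp (- (s * \<eta>)\<^sup>2 / 2))))"
    have i0: "integrable lborel (\<lambda>x. exp (- (s * x)\<^sup>2 / 2))"
      using integrable_norm[OF gaussian_fourier(1)[OF s, of 0]] by simp
    have Hint: "integrable (lborel \<Otimes>\<^sub>M lborel) (case_prod H)"
    proof (rule lborel_pair.Fubini_integrable)
      show "case_prod H \<in> borel_measurable (lborel \<Otimes>\<^sub>M lborel)" unfolding H_def by measurable
      have "(LBINT u. norm (H \<eta> u)) = exp (- (s * \<eta>)\<^sup>2 / 2) * (LBINT u. norm (g u))" for \<eta>
        by (simp add: H_def norm_mult)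
      then show "integrable lborel (\<lambda>\<eta>. LBINT u. norm (case (\<eta>, u) of (\<eta>, u) \<Rightarrow> H \<eta> u))"
        using i0 by simp
      have "integrable lborel (H \<eta>)" for \<eta>
        by (rule Bochner_Integration.integrable_bound[OF int]) (auto simp: H_def norm_mult mult_left_le)
      then show "AE \<eta> in lborel. integrable lborel (\<lambda>u. case (\<eta>, u) of (\<eta>, u) \<Rightarrow> H \<eta> u)" by simp
    qed
    have "(LBINT \<eta>. gh \<eta> * iexp (- (\<eta> * y)) * of_real (exp (- (s * \<eta>)\<^sup>2 / 2))) = (LBINT \<eta>. LBINT u. H \<eta> u)"
    proof (intro Bochner_Integration.integral_cong refl)
      fix \<eta>
      have "H \<eta> u = g u * iexp (\<eta> * u) * (iexp (- (\<eta> * y)) * of_real (exp (- (s * \<eta>)\<^sup>2 / 2)))" for u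
      proof -
        have "iexp (\<eta> * (u - y)) = iexp (\<eta> * u) * iexp (- (\<eta> * y))"
          unfolding exp_add[symmetric] by (simp add: algebra_simps)
        then show ?thesis unfolding H_def by (simp only: mult_ac)
      qed
      then show "gh \<eta> * iexp (- (\<eta> * y)) * of_real (exp (- (s * \<eta>)\<^sup>2 / 2)) = (LBINT u. H \<eta> u)"
        by (simp only: gh_def integral_mult_left_zero) (simp only: mult.assoc)
    qed
    also have "\<dots> = (LBINT u. LBINT \<eta>. H \<eta> u)"
      by (rule lborel_pair.Fubini_integral[OF Hint, symmetric])
    also have "\<dots> = (LBINT u. g u * of_real (sqrt (2 * pi) / s * exp (- ((u - y) / s)\<^sup>2 / 2)))"
      unfolding H_def by (simp only: integral_mult_right_zero gaussian_fourier(2)[OF s])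
    also have "\<dots> = \<bar>s\<bar> *\<^sub>R (LBINT x. g (y + s * x) * of_real (sqrt (2 * pi) / s * exp (- ((y + s * x - y) / s)\<^sup>2 / 2)))"
      using s by (intro lborel_integral_real_affine) auto
    also have "(\<lambda>x. g (y + s * x) * of_real (sqrt (2 * pi) / s * exp (- ((y + s * x - y) / s)\<^sup>2 / 2))) =
       (\<lambda>x. of_real (2 * pi / s) * (of_real (std_normal_density x) * g (y + s * x)))"
    proof
      fix x
      have "sqrt (2 * pi) / s * exp (- ((y + s * x - y) / s)\<^sup>2 / 2) = (2 * pi / s) * std_normal_density x"
        using s real_sqrt_mult_self[of "2 * pi"] by (simp add: std_normal_density_def field_simps)
      then show "g (y + s * x) * of_real (sqrt (2 * pi) / s * exp (- ((y + s * x - y) / s)\<^sup>2 / 2)) =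
         of_real (2 * pi / s) * (of_real (std_normal_density x) * g (y + s * x))"
        by (simp only: of_real_mult mult_ac)
    qed
    finally show ?thesis using s by (simp add: scaleR_conv_of_real)
  qed
  define s where "s = (\<lambda>n. 1 / (real n + 1))"
  have s: "s \<longlonglongrightarrow> 0" "\<And>n. s n > 0" unfolding s_def by real_asymp auto
  have lim1: "(\<lambda>n. LBINT \<eta>. gh \<eta> * iexp (- (\<eta> * y)) * of_real (exp (- (s n * \<eta>)\<^sup>2 / 2))) \<longlonglongrightarrow> (LBINT \<eta>. gh \<eta> * iexp (- (\<eta> * y)))"
  proof (rule integral_dominated_convergence[where w = "\<lambda>\<eta>. norm (gh \<eta>)"])
    show "AE \<eta> in lborel. (\<lambda>n. gh \<eta> * iexp (- (\<eta> * y)) * of_real (exp (- (s n * \<eta>)\<^sup>2 / 2))) \<longlonglongrightarrow> gh \<eta> * iexp (- (\<eta> * y))"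
    proof (rule AE_I2)
      fix \<eta>
      have "(\<lambda>n. gh \<eta> * iexp (- (\<eta> * y)) * of_real (exp (- (s n * \<eta>)\<^sup>2 / 2))) \<longlonglongrightarrow> gh \<eta> * iexp (- (\<eta> * y)) * of_real (exp (- (0 * \<eta>)\<^sup>2 / 2))"
        by (intro tendsto_intros s) auto
      then show "(\<lambda>n. gh \<eta> * iexp (- (\<eta> * y)) * of_real (exp (- (s n * \<eta>)\<^sup>2 / 2))) \<longlonglongrightarrow> gh \<eta> * iexp (- (\<eta> * y))" by simp
    qed
  qed (use ghint in \<open>auto simp: norm_mult mult_left_le\<close>)
  have "(\<lambda>n. LBINT x. of_real (std_normal_density x) * g (y + s n * x)) \<longlonglongrightarrow> (LBINT x. of_real (std_normal_density x) * g y)"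
  proof (rule integral_dominated_convergence[where w = "\<lambda>x. B * std_normal_density x"])
    show "AE x in lborel. (\<lambda>n. of_real (std_normal_density x) * g (y + s n * x)) \<longlonglongrightarrow> of_real (std_normal_density x) * g y"
    proof (rule AE_I2)
      fix x
      have "(\<lambda>n. y + s n * x) \<longlonglongrightarrow> y + 0 * x" by (intro tendsto_intros s)
      then have "(\<lambda>n. g (y + s n * x)) \<longlonglongrightarrow> g y" using isCont_tendsto_compose[OF cont] by simp
      then show "(\<lambda>n. of_real (std_normal_density x) * g (y + s n * x)) \<longlonglongrightarrow> of_real (std_normal_density x) * g y"
        by (intro tendsto_intros)
    qed
    show "AE x in lborel. norm (of_real (std_normal_density x) * g (y + s n * x)) \<le> B * std_normal_density x" for n
      using bd by (intro AE_I2) (simp add: norm_mult, subst mult.commute[of B], intro mult_left_mono bd, simp)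
  qed auto
  then have lim2: "(\<lambda>n. of_real (2 * pi) * (LBINT x. of_real (std_normal_density x) * g (y + s n * x))) \<longlonglongrightarrow> of_real (2 * pi) * (LBINT x. of_real (std_normal_density x) * g y)"
    by (rule tendsto_mult_left)
  have val: "(LBINT x. of_real (std_normal_density x) * g y) = g y"
  proof -
    have "(LBINT x. std_normal_density x) = 1" using prob_space.prob_space[OF prob_space_normal_density]
      integral_normal_density[of 1 0] by simp
    then have "(LBINT x. of_real (std_normal_density x)) = (1 :: complex)"
      by (simp only: integral_complex_of_real of_real_1)
    then show ?thesis by (simp only: integral_mult_left_zero mult_1)
  qed
  show ?thesis
    using LIMSEQ_unique[OF lim1[unfolded reg[OF s(2)]] lim2] by (simp only: gh_def val)
qed

lemma log_substitution:
  fixes G :: "real \<Rightarrow> complex"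
  assumes cont: "\<And>x. isCont G x" and int: "set_integrable lborel {0<..} (\<lambda>r. G (ln r) / of_real r)"
  shows "integrable lborel G" and "(LBINT u. G u) = (LBINT r:{0<..}. G (ln r) / of_real r)"
proof -
  have e: "einterval (ereal 0) \<infinity> = {0<..}" "einterval (-\<infinity>) \<infinity> = UNIV" by (auto simp: einterval_def)
  have lims: "((ereal \<circ> ln \<circ> real_of_ereal) \<longlongrightarrow> -\<infinity>) (at_right (ereal 0))"
     "((ereal \<circ> ln \<circ> real_of_ereal) \<longlongrightarrow> \<infinity>) (at_left \<infinity>)"
    by (simp_all add: ereal_tendsto_simps ln_at_0 ln_at_top)
  have n: "set_integrable lborel {0<..} (\<lambda>r. norm (G (ln r)) * (1 / r))"
    using set_integrable_norm[OF int] 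
    by (rule set_integrable_cong[THEN iffD1, rotated 3]) (auto simp: norm_divide)
  have "set_integrable lborel (einterval (-\<infinity>) \<infinity>) (\<lambda>u. norm (G u))"
    by (rule interval_integral_substitution_nonneg(1)[of "ereal 0" \<infinity> ln "\<lambda>r. 1 / r"])
       (use lims n cont in \<open>auto simp: e intro!: derivative_eq_intros continuous_intros\<close>)
  then have "integrable lborel (\<lambda>u. norm (G u))" by (simp add: e set_integrable_def)
  moreover have "G \<in> borel_measurable borel"
    using cont by (intro borel_measurable_continuous_onI) (simp add: continuous_on_eq_continuous_at)
  ultimately show G: "integrable lborel G"
    by (simp add: integrable_norm_iff)
  have "(LBINT u=-\<infinity>..\<infinity>. G u) = (LBINT r=ereal 0..\<infinity>. (1 / r) *\<^sub>R G (ln r))"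
  proof (rule interval_integral_substitution_integrable)
    show "set_integrable lborel (einterval (ereal 0) \<infinity>) (\<lambda>r. (1 / r) *\<^sub>R G (ln r))"
      using int unfolding e
      by (rule set_integrable_cong[THEN iffD1, rotated 3]) (auto simp: scaleR_conv_of_real)
    show "set_integrable lborel (einterval (-\<infinity>) \<infinity>) (\<lambda>x. G x)" using G by (simp add: e set_integrable_def)
  qed (use lims cont in \<open>auto intro!: derivative_eq_intros continuous_intros\<close>)
  then show "(LBINT u. G u) = (LBINT r:{0<..}. G (ln r) / of_real r)"
    by (simp add: interval_lebesgue_integral_def e scaleR_conv_of_real set_lebesgue_integral_def)
qed

text \<open>Fourier inversion for \<open>g u = exp (a u) * f (exp u)\<close>, via \<open>r = exp u\<close>.\<close>
lemma mellin_inversion: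
  fixes f :: "real \<Rightarrow> complex" and a :: complex
  assumes cont: "\<And>r. r > 0 \<Longrightarrow> isCont f r"
    and int: "set_integrable lborel {0<..} (\<lambda>r. of_real r powr (a - 1) * f r)"
    and bd: "\<And>r. r > 0 \<Longrightarrow> norm (of_real r powr a * f r) \<le> B"
    and Nint: "integrable lborel (\<lambda>\<eta>. LBINT r:{0<..}. of_real r powr (a + \<i> * of_real \<eta> - 1) * f r)"
    and v: "v > 0"
  shows "(LBINT \<eta>. (LBINT r:{0<..}. of_real r powr (a + \<i> * of_real \<eta> - 1) * f r) * of_real v powr (- (a + \<i> * of_real \<eta>)))
      = of_real (2 * pi) * f v"
proof -
  define g where "g = (\<lambda>u. exp (a * of_real u) * f (exp u))"
  have contg: "isCont g x" for x unfolding g_def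
    by (intro continuous_intros isCont_o2[OF _ cont]) auto
  have pw: "of_real r powr w = exp (w * of_real (ln r))" if "r > 0" for r :: real and w :: complex
    using that by (simp add: powr_def Ln_of_real)
  have sub: "g (ln r) * iexp (\<eta> * ln r) / of_real r = of_real r powr (a + \<i> * of_real \<eta> - 1) * f r" if r: "r > 0" for r \<eta>
    using r by (simp add: g_def powr_diff pw[OF r] exp_add ring_distribs mult_ac)
  have i: "set_integrable lborel {0<..} (\<lambda>r. g (ln r) * iexp (\<eta> * ln r) / of_real r)" for \<eta>
  proof (rule set_integrable_bound[OF int])
    show "set_borel_measurable lborel {0<..} (\<lambda>r. g (ln r) * iexp (\<eta> * ln r) / of_real r)"
    proof -
      have [measurable]: "g \<in> borel_measurable borel"
        using contg by (intro borel_measurable_continuous_onI) (simp add: continuous_on_eq_continuous_at)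
      show ?thesis unfolding set_borel_measurable_def by measurable
    qed
    show "AE r in lborel. r \<in> {0<..} \<longrightarrow> norm (g (ln r) * iexp (\<eta> * ln r) / of_real r) \<le> norm (of_real r powr (a - 1) * f r)"
      using sub by (intro AE_I2) (auto simp: norm_mult norm_powr_real_powr simp del: times_divide_eq_left)
  qed
  have gi: "integrable lborel (\<lambda>u. g u * iexp (\<eta> * u))" and
       ghat: "(LBINT u. g u * iexp (\<eta> * u)) = (LBINT r:{0<..}. of_real r powr (a + \<i> * of_real \<eta> - 1) * f r)" for \<eta>
  proof -
    have c: "isCont (\<lambda>u. g u * iexp (\<eta> * u)) x" for x by (intro continuous_intros contg)
    show "integrable lborel (\<lambda>u. g u * iexp (\<eta> * u))"
      by (rule log_substitution(1)[of "\<lambda>u. g u * iexp (\<eta> * u)", OF c i])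
    have "(LBINT u. g u * iexp (\<eta> * u)) = (LBINT r:{0<..}. g (ln r) * iexp (\<eta> * ln r) / of_real r)"
      by (rule log_substitution(2)[of "\<lambda>u. g u * iexp (\<eta> * u)", OF c i])
    also have "\<dots> = (LBINT r:{0<..}. of_real r powr (a + \<i> * of_real \<eta> - 1) * f r)"
      by (rule set_lebesgue_integral_cong) (simp, intro allI impI sub, simp)
    finally show "(LBINT u. g u * iexp (\<eta> * u)) = (LBINT r:{0<..}. of_real r powr (a + \<i> * of_real \<eta> - 1) * f r)" .
  qed
  have bdg: "norm (g u) \<le> B" for u
    using bd[of "exp u"] by (simp add: g_def pw)
  have 1: "(LBINT \<eta>. (LBINT u. g u * iexp (\<eta> * u)) * iexp (- (\<eta> * ln v))) = of_real (2 * pi) * g (ln v)"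
  proof (rule fourier_inversion[OF _ contg bdg])
    show "integrable lborel g" using gi[of 0] by simp
    show "integrable lborel (\<lambda>\<eta>. LBINT u. g u * iexp (\<eta> * u))" unfolding ghat by (rule Nint)
  qed
  have "(LBINT \<eta>. (LBINT r:{0<..}. of_real r powr (a + \<i> * of_real \<eta> - 1) * f r) * of_real v powr (- (a + \<i> * of_real \<eta>)))
    = (LBINT \<eta>. of_real v powr (- a) * ((LBINT u. g u * iexp (\<eta> * u)) * iexp (- (\<eta> * ln v))))"
  proof (intro Bochner_Integration.integral_cong refl)
    fix \<eta>
    have "of_real v powr (- (a + \<i> * of_real \<eta>)) = of_real v powr (- a) * iexp (- (\<eta> * ln v))"
      unfolding pw[OF v] exp_add[symmetric] by (simp add: algebra_simps)
    then show "(LBINT r:{0<..}. of_real r powr (a + \<i> * of_real \<eta> - 1) * f r) * of_real v powr (- (a + \<i> * of_real \<eta>)) =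
        of_real v powr (- a) * ((LBINT u. g u * iexp (\<eta> * u)) * iexp (- (\<eta> * ln v)))"
      unfolding ghat by (simp only: mult_ac)
  qed
  also have "\<dots> = of_real v powr (- a) * (of_real (2 * pi) * g (ln v))"
    by (simp only: integral_mult_right_zero 1)
  also have "g (ln v) = of_real v powr a * f v" using v by (simp add: g_def pw)
  also have "of_real v powr (- a) * (of_real (2 * pi) * (of_real v powr a * f v)) = of_real (2 * pi) * f v"
    using v by (simp add: powr_minus)
  finally show ?thesis .
qed

text \<open>Insert the definition of \<open>N1\<close> and integrate over \<open>\<eta>\<close> first. Since
\<open>t powr (a2 + \<i> \<eta>) = (1 / t) powr (- (a2 + \<i> \<eta>))\<close>, the inner integral is the inverse Mellin transform of \<open>N2\<close> at
\<open>1 / t\<close>.\<close>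
lemma mellin_parseval:
  fixes f1 f2 :: "real \<Rightarrow> complex" and a1 a2 :: complex
  defines "N1 \<equiv> (\<lambda>\<eta>::real. LBINT r:{0<..}. of_real r powr (a1 + \<i> * of_real \<eta> - 1) * f1 r)"
    and "N2 \<equiv> (\<lambda>\<eta>::real. LBINT r:{0<..}. of_real r powr (a2 + \<i> * of_real \<eta> - 1) * f2 r)"
  assumes [measurable]: "f1 \<in> borel_measurable borel"
    and int1: "set_integrable lborel {0<..} (\<lambda>r. of_real r powr (a1 - 1) * f1 r)"
    and cont: "\<And>r. r > 0 \<Longrightarrow> isCont f2 r"
    and int2: "set_integrable lborel {0<..} (\<lambda>r. of_real r powr (a2 - 1) * f2 r)"
    and bd: "\<And>r. r > 0 \<Longrightarrow> norm (of_real r powr a2 * f2 r) \<le> B"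
    and Nint: "integrable lborel N2"
  shows "integrable lborel (\<lambda>\<eta>. N1 \<eta> * N2 \<eta>)"
    and "(LBINT \<eta>. N1 \<eta> * N2 \<eta>) = of_real (2 * pi) * (LBINT t:{0<..}. of_real t powr (a1 - a2 - 1) * f1 t * f2 (1 / t))"
proof -
  note [measurable] = borel_measurable_integrable[OF Nint]
  define J where "J = (\<lambda>t \<eta>. (indicator {0<..} t *\<^sub>R (of_real t powr (a1 + \<i> * of_real \<eta> - 1) * f1 t)) * N2 \<eta>)"
  have nJ: "norm (J t \<eta>) = norm (indicator {0<..} t *\<^sub>R (of_real t powr (a1 - 1) * f1 t)) * norm (N2 \<eta>)" for t \<eta>
    by (auto simp: J_def norm_mult norm_powr_real_powr indicator_def)
  have [measurable]: "case_prod J \<in> borel_measurable (lborel \<Otimes>\<^sub>M lborel)"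
    unfolding J_def by measurable
  have Jint: "integrable (lborel \<Otimes>\<^sub>M lborel) (case_prod J)"
  proof (rule lborel_pair.Fubini_integrable)
    have "integrable lborel (\<lambda>t. norm (indicator {0<..} t *\<^sub>R (of_real t powr (a1 - 1) * f1 t)) * (LBINT \<eta>. norm (N2 \<eta>)))"
      using int1 unfolding set_integrable_def by (intro integrable_mult_left integrable_norm)
    then show "integrable lborel (\<lambda>t. LBINT \<eta>. norm (case (t, \<eta>) of (t, \<eta>) \<Rightarrow> J t \<eta>))"
      by (simp only: prod.case nJ integral_mult_right_zero)
    have "integrable lborel (J t)" for t
    proof (rule Bochner_Integration.integrable_bound)
      show "integrable lborel (\<lambda>\<eta>. norm (indicator {0<..} t *\<^sub>R (of_real t powr (a1 - 1) * f1 t)) * norm (N2 \<eta>))"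
        by (intro integrable_mult_right integrable_norm Nint)
    qed (auto simp: nJ)
    then show "AE t in lborel. integrable lborel (\<lambda>\<eta>. case (t, \<eta>) of (t, \<eta>) \<Rightarrow> J t \<eta>)" by simp
  qed measurable
  have eq1: "(LBINT t. J t \<eta>) = N1 \<eta> * N2 \<eta>" for \<eta>
    unfolding J_def N1_def set_lebesgue_integral_def by (simp only: integral_mult_left_zero)
  have eq2: "(LBINT \<eta>. J t \<eta>) = indicator {0<..} t *\<^sub>R (of_real (2 * pi) * (of_real t powr (a1 - a2 - 1) * f1 t * f2 (1 / t)))" for t
  proof (cases "t > 0")
    case t: True
    have "J t \<eta> = (of_real t powr (a1 - a2 - 1) * f1 t) * (N2 \<eta> * of_real (1 / t) powr (- (a2 + \<i> * of_real \<eta>)))" for \<eta>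
    proof -
      have "of_real (1 / t) powr (- (a2 + \<i> * of_real \<eta>)) = of_real t powr (a2 + \<i> * of_real \<eta>)"
        using t by (simp add: powr_def Ln_of_real ln_div algebra_simps del: of_real_divide)
      moreover have "of_real t powr (a1 + \<i> * of_real \<eta> - 1) = of_real t powr (a1 - a2 - 1) * of_real t powr (a2 + \<i> * of_real \<eta>)"
        unfolding powr_add[symmetric] by (simp add: algebra_simps)
      ultimately show ?thesis using t by (simp add: J_def mult_ac del: of_real_divide)
    qed
    then have "(LBINT \<eta>. J t \<eta>) = (of_real t powr (a1 - a2 - 1) * f1 t) * (LBINT \<eta>. N2 \<eta> * of_real (1 / t) powr (- (a2 + \<i> * of_real \<eta>)))"
      by (simp only: integral_mult_right_zero)
    also have "(LBINT \<eta>. N2 \<eta> * of_real (1 / t) powr (- (a2 + \<i> * of_real \<eta>))) = of_real (2 * pi) * f2 (1 / t)"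
      unfolding N2_def by (rule mellin_inversion[OF cont int2 bd Nint[unfolded N2_def]]) (use t in auto)
    finally show ?thesis using t by simp
  qed (simp add: J_def)
  show "integrable lborel (\<lambda>\<eta>. N1 \<eta> * N2 \<eta>)"
    using lborel_pair.integrable_snd[OF Jint] unfolding eq1 .
  have "(LBINT \<eta>. N1 \<eta> * N2 \<eta>) = (LBINT t. indicator {0<..} t *\<^sub>R (of_real (2 * pi) * (of_real t powr (a1 - a2 - 1) * f1 t * f2 (1 / t))))"
    using lborel_pair.Fubini_integral[OF Jint] unfolding eq1 eq2 .
  then show "(LBINT \<eta>. N1 \<eta> * N2 \<eta>) = of_real (2 * pi) * (LBINT t:{0<..}. of_real t powr (a1 - a2 - 1) * f1 t * f2 (1 / t))"
    unfolding set_integral_mult_right[symmetric] by (simp only: set_lebesgue_integral_def)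
qed

section \<open>The Mellin-Barnes integral as an integral over the half-line\<close>

text \<open>The function \<open>u powr N * exp (- d u)\<close> has its maximum at \<open>u = N / d\<close>; dropping the factor
\<open>exp (- N)\<close> there leaves a bound that follows from \<open>v \<le> exp v\<close> alone.\<close>
lemma powr_times_exp_le:
  fixes u N d :: real
  assumes "u > 0" "N > 0" "d > 0"
  shows "u powr N * exp (- d * u) \<le> (N / d) powr N"
proof -
  have "d * u / N \<le> exp (d * u / N)" using exp_ge_add_one_self[of "d * u / N"] by linarith
  then have "(d * u / N) powr N \<le> exp (d * u / N) powr N"
    using assms by (intro powr_mono2) auto
  also have "exp (d * u / N) powr N = exp (d * u)" using assms by (simp add: powr_def)
  finally have "(d * u / N) powr N \<le> exp (d * u)" .
  moreover have "(d * u / N) powr N * (N / d) powr N = u powr N"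
    using assms by (simp add: powr_mult[symmetric])
  ultimately have "u powr N \<le> exp (d * u) * (N / d) powr N"
    by (metis mult_right_mono powr_ge_zero)
  then show ?thesis by (simp add: exp_minus field_simps)
qed

lemma set_integrable_powr_exp_both_ends:
  fixes m d :: real
  assumes d: "d > 0"
  shows "set_integrable lborel {0<..} (\<lambda>t. t powr m * exp (- d * t - d / t))"
proof -
  \<comment> \<open>The factor \<open>exp (- d / t)\<close> is \<open>O(t powr N)\<close>, and \<open>m + N > - 1\<close> makes the Gamma integral converge there.\<close>
  define N where "N = \<bar>m\<bar> + 1"
  have N: "N > 0" "m + N + 1 > 0" by (auto simp: N_def)
  have i: "set_integrable lborel {0<..} (\<lambda>t. (N / d) powr N * (t powr (m + N + 1 - 1) * exp (- d * t)))"
    by (intro set_integrable_mult_right set_integrable_powr_exp N d)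
  show ?thesis
  proof (rule set_integrable_bound[OF i])
    show "set_borel_measurable lborel {0<..} (\<lambda>t. t powr m * exp (- d * t - d / t))"
      unfolding set_borel_measurable_def by measurable
    have "t powr m * exp (- d * t - d / t) \<le> (N / d) powr N * (t powr (m + N + 1 - 1) * exp (- d * t))" if t: "t > 0" for t
    proof -
      have "(1 / t) powr N * exp (- d * (1 / t)) \<le> (N / d) powr N"
        using t N d by (intro powr_times_exp_le) auto
      then have "exp (- d / t) \<le> (N / d) powr N * t powr N"
        using t by (simp add: powr_divide field_simps)
      then have "t powr m * exp (- d * t) * exp (- d / t) \<le> t powr m * exp (- d * t) * ((N / d) powr N * t powr N)"
        by (intro mult_left_mono) auto
      then show ?thesis by (simp add: powr_add exp_diff exp_minus field_simps)
    qed
    then show "AE t in lborel. t \<in> {0<..} \<longrightarrow> norm (t powr m * exp (- d * t - d / t)) \<le>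
        norm ((N / d) powr N * (t powr (m + N + 1 - 1) * exp (- d * t)))"
      by (intro AE_I2 impI) auto
  qed
qed

lemma integrable_exp_abs:
  fixes d s :: real
  assumes d: "d > 0"
  shows "integrable lborel (\<lambda>u. exp (- d * \<bar>s + u\<bar>))"
proof -
  define f where "f = (\<lambda>u::real. indicator {0<..} u * exp (- d * u))"
  have "set_integrable lborel {0<..} (\<lambda>u. u powr (1 - 1) * exp (- d * u))"
    by (rule set_integrable_powr_exp) (use d in auto)
  then have f: "integrable lborel f"
    unfolding set_integrable_def
    by (rule Bochner_Integration.integrable_cong[THEN iffD1, rotated 2]) (auto simp: f_def indicator_def)
  have f': "integrable lborel (\<lambda>u. f (0 + (-1) * u))"
    by (intro lborel_integrable_real_affine f) auto
  have "integrable lborel (\<lambda>u. exp (- d * \<bar>u\<bar>))"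
  proof (rule Bochner_Integration.integrable_bound[OF Bochner_Integration.integrable_add[OF f f']])
    \<comment> \<open>Both halves of the sum vanish at 0, so the bound fails at this one point.\<close>
    have "AE u in lborel. u \<noteq> (0::real)" by (rule AE_lborel_singleton)
    then show "AE u in lborel. norm (exp (- d * \<bar>u\<bar>)) \<le> norm (f u + f (0 + (-1) * u))"
      by eventually_elim (auto simp: f_def indicator_def abs_if)
  qed auto
  then have "integrable lborel (\<lambda>u. exp (- d * \<bar>s + 1 * u\<bar>))"
    by (intro lborel_integrable_real_affine[where f = "\<lambda>u. exp (- d * \<bar>u\<bar>)"]) auto
  then show ?thesis by simp
qed

lemma norm_cos_le_exp:
  fixes u :: complex
  shows "norm (cos u) \<le> exp (norm u)"
proof -
  have "norm (exp (\<i> * u) + exp (- (\<i> * u))) \<le> exp (norm u) + exp (norm u)"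
    using norm_exp[of "\<i> * u"] norm_exp[of "- (\<i> * u)"]
    by (intro norm_triangle_le add_mono) (simp_all add: norm_mult)
  then show ?thesis by (simp add: cos_exp_eq norm_divide)
qed

text \<open>The growth \<open>exp (\<bar>k\<bar> sqrt r)\<close> of the cosine costs at most half of the exponential decay and a constant.\<close>
lemma norm_exp_cos_sqrt_le:
  fixes X k :: complex and r :: real
  assumes X: "Re X > 0" and r: "r > 0"
  shows "norm (exp (- X * of_real r) * cos (k * of_real (sqrt r))) \<le>
     exp ((norm k)\<^sup>2 / (2 * Re X)) * exp (- (Re X / 2) * r)"
proof -
  have "0 \<le> (sqrt (Re X) * sqrt r - norm k / sqrt (Re X))\<^sup>2" by simp
  also have "\<dots> = Re X * r - 2 * norm k * sqrt r + (norm k)\<^sup>2 / Re X"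
    using X r by (simp add: power2_diff power_mult_distrib power_divide)
  finally have am_gm: "- (Re X * r) + norm k * sqrt r \<le> (norm k)\<^sup>2 / (2 * Re X) + - (Re X / 2) * r"
    using X by (simp add: field_simps)
  have "norm (exp (- X * of_real r) * cos (k * of_real (sqrt r))) \<le> exp (- (Re X * r)) * exp (norm k * sqrt r)"
    using norm_cos_le_exp[of "k * of_real (sqrt r)"] r by (simp add: norm_mult)
  also have "\<dots> = exp (- (Re X * r) + norm k * sqrt r)" by (simp only: exp_add)
  also have "\<dots> \<le> exp ((norm k)\<^sup>2 / (2 * Re X) + - (Re X / 2) * r)" using am_gm by simp
  finally show ?thesis by (simp only: exp_add)
qed

text \<open>The Mellin transform of \<open>exp (- r) * cos (w * sqrt r)\<close>, continued by the power series of \<open>1F1\<close>.\<close>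
definition gamma_1F1 :: "complex \<Rightarrow> complex \<Rightarrow> complex" where
  "gamma_1F1 w a = Gamma a * hyp_1F1 a (1/2) (- (w\<^sup>2 / 4))"

lemma mellin_exp_cos:
  fixes a p w k :: complex
  assumes a: "Re a > 0" and p: "Re p > 0" and k: "k\<^sup>2 = w\<^sup>2 * p"
  shows "set_integrable lborel {0<..} (\<lambda>r. of_real r powr (a - 1) * (exp (- p * of_real r) * cos (k * of_real (sqrt r))))"
    and "(LBINT r:{0<..}. of_real r powr (a - 1) * (exp (- p * of_real r) * cos (k * of_real (sqrt r))))
          = gamma_1F1 w a * p powr (- a)"
proof -
  have "p \<noteq> 0" using p by auto
  then have "k\<^sup>2 / (4 * p) = w\<^sup>2 / 4" by (simp add: k)
  then show "set_integrable lborel {0<..} (\<lambda>r. of_real r powr (a - 1) * (exp (- p * of_real r) * cos (k * of_real (sqrt r))))"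
    and "(LBINT r:{0<..}. of_real r powr (a - 1) * (exp (- p * of_real r) * cos (k * of_real (sqrt r))))
          = gamma_1F1 w a * p powr (- a)"
    using laplace_cos_sqrt[OF a p, of k] by (simp_all only: gamma_1F1_def mult_ac)
qed

text \<open>Take \<open>p = cis \<theta>\<close> in \<open>mellin_exp_cos\<close>. On the line \<open>Re a = \<sigma>\<close> the transform is bounded by the integral
of the modulus of its integrand, which does not depend on \<open>Im a\<close>, while \<open>\<bar>p powr (- a)\<bar> = exp (\<theta> * Im a)\<close>.\<close>
lemma norm_gamma_1F1_le:
  fixes w :: complex and \<sigma> \<theta> :: real
  assumes \<sigma>: "\<sigma> > 0" and \<theta>: "\<bar>\<theta>\<bar> < pi / 2"
  shows "\<exists>C. \<forall>a. Re a = \<sigma> \<longrightarrow> norm (gamma_1F1 w a) \<le> C * exp (- \<theta> * Im a)"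
proof -
  define p where "p = cis \<theta>"
  define k where "k = w * csqrt p"
  have p: "Re p > 0" using \<theta> by (auto simp: p_def intro!: cos_gt_zero_pi)
  have k: "k\<^sup>2 = w\<^sup>2 * p" by (simp add: k_def power_mult_distrib)
  define h where "h = (\<lambda>r::real. exp (- p * of_real r) * cos (k * of_real (sqrt r)))"
  define C where "C = (LBINT r:{0<..}. norm (of_real r powr (of_real \<sigma> - 1) * h r))"
  show ?thesis
  proof (intro exI[of _ C] allI impI)
    fix a :: complex assume a: "Re a = \<sigma>"
    have Ln: "Ln p = \<i> * of_real \<theta>" unfolding p_def using \<theta> by (subst Ln_cis) auto
    have "norm (p powr (- a)) = exp (\<theta> * Im a)"
      using p by (auto simp: powr_def Ln)
    then have "norm (gamma_1F1 w a) * exp (\<theta> * Im a) = norm (gamma_1F1 w a * p powr (- a))"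
      by (simp add: norm_mult)
    also have "\<dots> = norm (LBINT r:{0<..}. of_real r powr (a - 1) * h r)"
      unfolding h_def using a \<sigma> p k by (subst mellin_exp_cos(2)) auto
    also have "\<dots> \<le> (LBINT r:{0<..}. norm (of_real r powr (a - 1) * h r))"
      unfolding h_def by (rule set_integral_norm_bound[OF mellin_exp_cos(1)]) (use a \<sigma> p k in auto)
    also have "\<dots> = C"
      unfolding C_def by (rule set_lebesgue_integral_cong) (auto simp: norm_mult norm_powr_real_powr a)
    finally show "norm (gamma_1F1 w a) \<le> C * exp (- \<theta> * Im a)"
      by (simp add: exp_minus field_simps)
  qed
qed

text \<open>Apply the previous bound with \<open>\<plusminus> \<theta>\<close>, where \<open>\<theta>\<close> lies halfway between \<open>\<bar>Arg X\<bar>\<close> and \<open>pi / 2\<close>.\<close>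
lemma gamma_1F1_decay:
  fixes w X :: complex and \<sigma> :: real
  assumes \<sigma>: "\<sigma> > 0" and X: "Re X > 0"
  shows "\<exists>C d. d > 0 \<and> (\<forall>a. Re a = \<sigma> \<longrightarrow> norm (gamma_1F1 w a * X powr (- a)) \<le> C * exp (- d * \<bar>Im a\<bar>))"
proof -
  have X0: "X \<noteq> 0" using X by auto
  define \<phi> where "\<phi> = Im (Ln X)"
  have \<phi>: "\<bar>\<phi>\<bar> < pi / 2" unfolding \<phi>_def using Re_Ln_pos_lt[OF X0] X by simp
  define \<theta> where "\<theta> = (\<bar>\<phi>\<bar> + pi / 2) / 2"
  have \<theta>: "\<bar>\<phi>\<bar> < \<theta>" "\<bar>\<theta>\<bar> < pi / 2" "\<bar>- \<theta>\<bar> < pi / 2" "\<theta> > 0"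
    using \<phi> abs_ge_zero[of \<phi>] by (auto simp: \<theta>_def abs_if)
  obtain C1 where C1: "\<And>a. Re a = \<sigma> \<Longrightarrow> norm (gamma_1F1 w a) \<le> C1 * exp (- \<theta> * Im a)"
    using norm_gamma_1F1_le[OF \<sigma> \<theta>(2)] by blast
  obtain C2 where C2: "\<And>a. Re a = \<sigma> \<Longrightarrow> norm (gamma_1F1 w a) \<le> C2 * exp (\<theta> * Im a)"
    using norm_gamma_1F1_le[OF \<sigma> \<theta>(3)] by auto
  define C where "C = max C1 C2"
  have C: "norm (gamma_1F1 w a) \<le> C * exp (- \<theta> * \<bar>Im a\<bar>)" if "Re a = \<sigma>" for a
  proof (cases "Im a \<ge> 0")
    case True
    have "norm (gamma_1F1 w a) \<le> C1 * exp (- \<theta> * Im a)" by (rule C1[OF that])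
    also have "\<dots> \<le> C * exp (- \<theta> * Im a)" by (intro mult_right_mono) (auto simp: C_def)
    finally show ?thesis using True by simp
  next
    case False
    have "norm (gamma_1F1 w a) \<le> C2 * exp (\<theta> * Im a)" by (rule C2[OF that])
    also have "\<dots> \<le> C * exp (\<theta> * Im a)" by (intro mult_right_mono) (auto simp: C_def)
    finally show ?thesis using False by simp
  qed
  show ?thesis
  proof (rule exI[of _ "C * norm X powr (- \<sigma>)"], rule exI[of _ "\<theta> - \<bar>\<phi>\<bar>"], intro conjI allI impI)
    show "\<theta> - \<bar>\<phi>\<bar> > 0" using \<theta> by simp
    fix a :: complex assume a: "Re a = \<sigma>"
    have C0: "0 \<le> C * exp (- \<theta> * \<bar>Im a\<bar>)" using C[OF a] norm_ge_zero order_trans by blast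
    have "norm (X powr (- a)) = exp (- \<sigma> * ln (norm X) + \<phi> * Im a)"
      using X0 a by (simp add: powr_def \<phi>_def algebra_simps)
    also have "\<dots> \<le> exp (- \<sigma> * ln (norm X) + \<bar>\<phi>\<bar> * \<bar>Im a\<bar>)"
      using abs_ge_self[of "\<phi> * Im a"] by (simp add: abs_mult)
    also have "\<dots> = norm X powr (- \<sigma>) * exp (\<bar>\<phi>\<bar> * \<bar>Im a\<bar>)"
      using X0 by (simp add: powr_def exp_add[symmetric])
    finally have "norm (gamma_1F1 w a * X powr (- a)) \<le>
        (C * exp (- \<theta> * \<bar>Im a\<bar>)) * (norm X powr (- \<sigma>) * exp (\<bar>\<phi>\<bar> * \<bar>Im a\<bar>))"
      unfolding norm_mult using C[OF a] C0 by (intro mult_mono) auto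
    also have "\<dots> = C * norm X powr (- \<sigma>) * (exp (- \<theta> * \<bar>Im a\<bar>) * exp (\<bar>\<phi>\<bar> * \<bar>Im a\<bar>))"
      by (simp only: mult_ac)
    also have "exp (- \<theta> * \<bar>Im a\<bar>) * exp (\<bar>\<phi>\<bar> * \<bar>Im a\<bar>) = exp (- (\<theta> - \<bar>\<phi>\<bar>) * \<bar>Im a\<bar>)"
      unfolding exp_add[symmetric] by (simp add: algebra_simps)
    finally show "norm (gamma_1F1 w a * X powr (- a)) \<le> C * norm X powr (- \<sigma>) * exp (- (\<theta> - \<bar>\<phi>\<bar>) * \<bar>Im a\<bar>)" .
  qed
qed

lemma bessel_K_integrand_eq:
  assumes "x \<noteq> 0"
  shows "bessel_K_integrand z w x s =
    1 / 4 * (gamma_1F1 w ((s - z) / 2) * (x / 2) powr (- ((s - z) / 2)) * (gamma_1F1 w ((s + z) / 2) * (x / 2) powr (- ((s + z) / 2))))"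
proof -
  have Ln: "Ln (x / 2) = Ln x - Ln 2"
    using Ln_divide_of_real[of 2 x] assms Ln_of_real[of 2] by simp
  have "(x / 2) powr (- ((s - z) / 2)) * (x / 2) powr (- ((s + z) / 2)) = (x / 2) powr (- s)"
    unfolding powr_add[symmetric] by (simp add: field_simps)
  also have "\<dots> = 2 powr s * x powr (- s)"
    using assms by (simp add: powr_def Ln exp_add[symmetric] algebra_simps)
  also have "2 powr s = 4 * (2 powr (s - 2) :: complex)"
    by (simp add: powr_diff)
  finally have "2 powr (s - 2) * x powr (- s) =
     1 / 4 * ((x / 2) powr (- ((s - z) / 2)) * (x / 2) powr (- ((s + z) / 2)))" by simp
  note powers = this
  have "bessel_K_integrand z w x s =
    gamma_1F1 w ((s - z) / 2) * gamma_1F1 w ((s + z) / 2) * (2 powr (s - 2) * x powr (- s))"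
    unfolding bessel_K_integrand_def gamma_1F1_def by (simp only: mult_ac)
  then show ?thesis unfolding powers by (simp only: mult_ac)
qed

text \<open>Parseval with \<open>f1 = f2 = h\<close> on the lines through \<open>a1 = (c - z) / 2\<close> and \<open>a2 = (c + z) / 2\<close>. Both
lie in the right half-plane because \<open>c > \<bar>Re z\<bar>\<close>, and \<open>s = c + \<i> t\<close> corresponds to \<open>\<eta> = t / 2\<close>.\<close>
lemma bessel_K_single_integral:
  fixes w z x k :: complex and c :: real
  assumes x: "Re x > 0" and c: "c > \<bar>Re z\<bar>" and k: "k\<^sup>2 = w\<^sup>2 * (x / 2)"
  defines "h \<equiv> (\<lambda>r::real. exp (- (x / 2) * of_real r) * cos (k * of_real (sqrt r)))"
  shows "vertical_integrable c (bessel_K_integrand z w x)"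
    and "bessel_K c z w x = 1 / 2 * (LBINT t:{0<..}. of_real t powr (- z - 1) * h t * h (1 / t))"
proof -
  define X where "X = x / 2"
  have X: "Re X > 0" using x by (simp add: X_def)
  have x0: "x \<noteq> 0" using x by auto
  define a1 a2 where "a1 = (of_real c - z) / 2" and "a2 = (of_real c + z) / 2"
  have a: "Re a1 > 0" "Re a2 > 0" using c by (auto simp: a1_def a2_def)
  define N where "N = (\<lambda>a (\<eta>::real). gamma_1F1 w (a + \<i> * of_real \<eta>) * X powr (- (a + \<i> * of_real \<eta>)))"
  have hm [measurable]: "h \<in> borel_measurable borel" unfolding h_def by measurable
  have N: "(LBINT r:{0<..}. of_real r powr (a + \<i> * of_real \<eta> - 1) * h r) = N a \<eta>" if "Re a > 0" for a \<eta>
    unfolding h_def N_def X_def by (rule mellin_exp_cos(2)) (use that x k in auto)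
  have int: "set_integrable lborel {0<..} (\<lambda>r. of_real r powr (a - 1) * h r)" if "Re a > 0" for a
    unfolding h_def by (rule mellin_exp_cos(1)) (use that x k in auto)
  have N2: "integrable lborel (N a2)"
  proof -
    obtain C d where d: "d > 0" and C: "\<And>a. Re a = Re a2 \<Longrightarrow> norm (gamma_1F1 w a * X powr (- a)) \<le> C * exp (- d * \<bar>Im a\<bar>)"
      using gamma_1F1_decay[OF a(2) X, of w] by blast
    show ?thesis
    proof (rule Bochner_Integration.integrable_bound)
      show "integrable lborel (\<lambda>\<eta>. C * exp (- d * \<bar>Im a2 + \<eta>\<bar>))"
        by (intro integrable_mult_right integrable_exp_abs d)
      have "(\<lambda>\<eta>. LBINT r:{0<..}. of_real r powr (a2 + \<i> * of_real \<eta> - 1) * h r) \<in> borel_measurable lborel"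
        unfolding set_lebesgue_integral_def by measurable
      then show "N a2 \<in> borel_measurable lborel" unfolding N[OF a(2)] .
      show "AE \<eta> in lborel. norm (N a2 \<eta>) \<le> norm (C * exp (- d * \<bar>Im a2 + \<eta>\<bar>))"
      proof (rule AE_I2)
        fix \<eta> :: real
        have "norm (N a2 \<eta>) \<le> C * exp (- d * \<bar>Im a2 + \<eta>\<bar>)"
          using C[of "a2 + \<i> * of_real \<eta>"] unfolding N_def by simp
        then show "norm (N a2 \<eta>) \<le> norm (C * exp (- d * \<bar>Im a2 + \<eta>\<bar>))"
          unfolding real_norm_def by linarith
      qed
    qed
  qed
  define B where "B = exp ((norm k)\<^sup>2 / (2 * Re X)) * (Re a2 / (Re X / 2)) powr Re a2"
  have bd: "norm (of_real r powr a2 * h r) \<le> B" if r: "r > 0" for r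
  proof -
    have "norm (of_real r powr a2 * h r) \<le> r powr Re a2 * (exp ((norm k)\<^sup>2 / (2 * Re X)) * exp (- (Re X / 2) * r))"
    proof -
      have "norm (h r) \<le> exp ((norm k)\<^sup>2 / (2 * Re X)) * exp (- (Re X / 2) * r)"
        unfolding h_def X_def[symmetric] by (rule norm_exp_cos_sqrt_le[OF X r])
      moreover have "norm (of_real r powr a2) = r powr Re a2"
        using r by (simp add: norm_powr_real_powr)
      ultimately show ?thesis
        unfolding norm_mult[of "of_real r powr a2"] by (simp only: mult_left_mono powr_ge_zero)
    qed
    also have "\<dots> = exp ((norm k)\<^sup>2 / (2 * Re X)) * (r powr Re a2 * exp (- (Re X / 2) * r))" by (simp only: mult_ac)
    also have "\<dots> \<le> B" unfolding B_def
      by (intro mult_left_mono powr_times_exp_le) (use r a X in auto)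
    finally show ?thesis .
  qed
  have cont: "isCont h r" for r unfolding h_def by (intro continuous_intros)
  define N12 where "N12 = (\<lambda>\<eta>. N a1 \<eta> * N a2 \<eta>)"
  define J where "J = (LBINT t:{0<..}. of_real t powr (- z - 1) * h t * h (1 / t))"
  have a12: "a1 - a2 - 1 = - z - 1" by (simp add: a1_def a2_def field_simps)
  note parseval = mellin_parseval[OF hm int[OF a(1)] cont int[OF a(2)] bd, unfolded N[OF a(1)] N[OF a(2)] a12, OF _ N2]
  have N12i: "integrable lborel N12" unfolding N12_def by (rule parseval(1))
  have N12v: "(LBINT \<eta>. N12 \<eta>) = of_real (2 * pi) * J" unfolding N12_def J_def by (rule parseval(2))
  have line: "bessel_K_integrand z w x (Complex c t) = 1 / 4 * N12 (0 + 1 / 2 * t)" for t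
  proof -
    have "(Complex c t - z) / 2 = a1 + \<i> * of_real (0 + 1 / 2 * t)" "(Complex c t + z) / 2 = a2 + \<i> * of_real (0 + 1 / 2 * t)"
      by (simp_all add: a1_def a2_def complex_eq_iff)
    then show ?thesis unfolding bessel_K_integrand_eq[OF x0] N12_def N_def X_def by (simp only:)
  qed
  have i2: "integrable lborel (\<lambda>t. N12 (0 + 1 / 2 * t))"
    by (intro lborel_integrable_real_affine N12i) auto
  show "vertical_integrable c (bessel_K_integrand z w x)"
    unfolding vertical_integrable_def line by (intro integrable_mult_left integrable_mult_right i2)
  have "(LBINT \<eta>. N12 \<eta>) = \<bar>1 / 2\<bar> *\<^sub>R (LBINT t. N12 (0 + 1 / 2 * t))"
    by (intro lborel_integral_real_affine) auto
  then have "(LBINT t. N12 (0 + 1 / 2 * t)) = 2 * (of_real (2 * pi) * J)"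
    unfolding N12v by (simp add: scaleR_conv_of_real)
  then have "vertical_integral c (bessel_K_integrand z w x) = 1 / 4 * (2 * (of_real (2 * pi) * J)) * \<i>"
    unfolding vertical_integral_def line by (simp only: integral_mult_left_zero integral_mult_right_zero)
  then show "bessel_K c z w x = 1 / 2 * J"
    unfolding bessel_K_def by simp
qed

section \<open>The iterated integral as an integral over the half-line\<close>

text \<open>The form of the growth bound that \<open>laplace_fubini\<close> asks for.\<close>
lemma hyp_0F2_linear_bound:
  fixes a b \<beta> :: complex and e :: real
  assumes "Re a > 0" "Re b > 0" and e: "e > 0"
  obtains C where "C \<ge> 0" "\<And>y. y > 0 \<Longrightarrow> norm (hyp_0F2 a b (- (\<beta> * of_real y))) \<le> C * exp (e * sqrt y)"
proof -
  define e' where "e' = e / (sqrt (norm \<beta>) + 1)"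
  have pos: "sqrt (norm \<beta>) + 1 > 0" by (simp add: add_nonneg_pos)
  have e': "e' > 0" using e pos by (simp add: e'_def)
  obtain C where C: "C \<ge> 0" "\<And>u. norm (hyp_0F2 a b u) \<le> C * exp (e' * sqrt (norm u))"
    using hyp_0F2_bound[OF assms(1,2) e'] by blast
  have le: "e' * sqrt (norm \<beta>) \<le> e"
    using e pos by (simp add: e'_def field_simps)
  have "norm (hyp_0F2 a b (- (\<beta> * of_real y))) \<le> C * exp (e * sqrt y)" if y: "y > 0" for y
  proof -
    have "norm (hyp_0F2 a b (- (\<beta> * of_real y))) \<le> C * exp (e' * sqrt (norm (- (\<beta> * of_real y))))" by (rule C)
    also have "e' * sqrt (norm (- (\<beta> * of_real y))) = (e' * sqrt (norm \<beta>)) * sqrt y"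
      using y by (simp add: norm_mult real_sqrt_mult)
    also have "C * exp ((e' * sqrt (norm \<beta>)) * sqrt y) \<le> C * exp (e * sqrt y)"
      using le y C by (intro mult_left_mono) auto
    finally show ?thesis .
  qed
  with C(1) show ?thesis by (rule that)
qed

lemma hyp_0F2_measurable [measurable]:
  "hyp_0F2 a b \<in> borel_measurable borel"
  unfolding hyp_0F2_def[abs_def] by measurable

text \<open>Square roots of points of the right half-plane lie in the sector \<open>\<bar>Im\<bar> < Re\<close>, so the product of two of them
still has positive real part and is the principal square root of the product.\<close>
lemma exp_csqrt_product_integral:
  fixes A B :: complex
  assumes A: "Re A > 0" and B: "Re B > 0"
  shows "exp (- 2 * csqrt (A * B)) / csqrt B =
     1 / of_real (sqrt pi) * (LBINT t:{0<..}. exp (- B * of_real t - A / of_real t) / of_real (sqrt t))"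
proof -
  have Re_pos: "Re (csqrt u) > 0" if "Re u > 0" for u
  proof (rule ccontr)
    assume "\<not> Re (csqrt u) > 0"
    then have "Re (csqrt u) = 0" using Re_csqrt[of u] by linarith
    then have "Re ((csqrt u)\<^sup>2) \<le> 0" by (simp add: power2_eq_square)
    then show False using that by simp
  qed
  define a b where "a = csqrt A" and "b = csqrt B"
  have sq: "a\<^sup>2 = A" "b\<^sup>2 = B" by (simp_all add: a_def b_def)
  have pos: "Re a > 0" "Re b > 0" using Re_pos A B by (auto simp: a_def b_def)
  have im: "\<bar>Im u\<bar> < Re u" if "Re u > 0" "Re (u\<^sup>2) > 0" for u
    using that by (intro power2_less_imp_less[of "\<bar>Im u\<bar>"]) (auto simp: power2_eq_square)
  have "\<bar>Im a * Im b\<bar> < Re a * Re b"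
    unfolding abs_mult using im[of a] im[of b] pos sq A B by (intro mult_strict_mono) auto
  then have "Re (a * b) > 0" by simp
  then have "csqrt (A * B) = a * b"
    by (intro csqrt_unique) (simp_all add: power_mult_distrib sq)
  moreover have "b \<noteq> 0" using pos by auto
  ultimately show ?thesis
    using bessel_half_integral[of a b] pos sq A B
    by (simp add: b_def[symmetric] mult_ac)
qed

text \<open>Fubini is applied twice in two variables, rather than once in three, which also yields the
integrability of \<open>F y\<close> for every single \<open>y\<close>. In the integral over \<open>t\<close> the auxiliary variable \<open>s\<close> enters as
\<open>1 / s\<close> with exponent \<open>b = 1/2\<close>; in the integral over \<open>y\<close> it enters as \<open>s\<close> with \<open>b = 1 + z\<close>.
The growth rate \<open>sqrt (Re X)\<close> allowed for \<open>0F2\<close> is such that the resulting loss uses up half of the decay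
supplied by \<open>exp (- X s)\<close> and \<open>exp (- X / s)\<close>, respectively.\<close>
lemma iterated_integral_single_integral:
  fixes X z \<beta> k :: complex
  assumes X: "Re X > 0" and z: "Re z > -1" and k: "k\<^sup>2 = 4 * \<beta>"
  defines "F \<equiv> (\<lambda>(y::real) (t::real).
            of_real y powr z * of_real t powr (- 1 / 2) / csqrt (of_real y + X)
            * exp (- 2 * csqrt ((of_real t + X) * (of_real y + X)))
            * hyp_0F2 (1 / 2) (1 + z) (- (\<beta> * of_real y))
            * hyp_0F2 (1 / 2) (1 / 2) (- (\<beta> * of_real t)))"
    and "h \<equiv> (\<lambda>r::real. exp (- X * of_real r) * cos (k * of_real (sqrt r)))"
  shows "\<And>y. y > 0 \<Longrightarrow> set_integrable lborel {0<..} (F y)"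
    and "set_integrable lborel {0<..} (\<lambda>y. LBINT t:{0<..}. F y t)"
    and "(LBINT y:{0<..}. LBINT t:{0<..}. F y t) =
      Gamma (1 + z) * (LBINT t:{0<..}. of_real t powr (- z - 1) * h t * h (1 / t))"
proof -
  define \<xi> where "\<xi> = Re X"
  have \<xi>: "\<xi> > 0" using X by (simp add: \<xi>_def)
  define U V where "U = (\<lambda>y::real. hyp_0F2 (1 / 2) (1 + z) (- (\<beta> * of_real y)))"
    and "V = (\<lambda>t::real. hyp_0F2 (1 / 2) (1 / 2) (- (\<beta> * of_real t)))"
  have [measurable]: "U \<in> borel_measurable borel" "V \<in> borel_measurable borel"
    unfolding U_def V_def by measurable
  obtain CU where CU: "CU \<ge> 0" "\<And>y. y > 0 \<Longrightarrow> norm (U y) \<le> CU * exp (sqrt \<xi> * sqrt y)"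
    using hyp_0F2_linear_bound[of "1/2" "1 + z" "sqrt \<xi>" \<beta>] z \<xi> unfolding U_def by auto
  obtain CV where CV: "CV \<ge> 0" "\<And>y. y > 0 \<Longrightarrow> norm (V y) \<le> CV * exp (sqrt \<xi> * sqrt y)"
    using hyp_0F2_linear_bound[of "1/2" "1/2" "sqrt \<xi>" \<beta>] \<xi> unfolding V_def by auto
  define g1 where "g1 = (\<lambda>y (s::real). exp (- (of_real y + X) * of_real s - X / of_real s) / of_real (sqrt s))"
  define H1 where "H1 = (\<lambda>y s t. g1 y s * (of_real t powr (1/2 - 1) * exp (- of_real (1 / s) * of_real t) * V t))"
  define c where "c = (\<lambda>y. 1 / of_real (sqrt pi) * of_real y powr z * U y)"
  have F_eq: "F y t = c y * (LBINT s:{0<..}. H1 y s t)" if y: "y > 0" and t: "t > 0" for y t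
  proof -
    have *: "exp (- 2 * csqrt ((of_real t + X) * (of_real y + X))) / csqrt (of_real y + X) =
      1 / of_real (sqrt pi) * (LBINT s:{0<..}. exp (- (of_real y + X) * of_real s - (of_real t + X) / of_real s) / of_real (sqrt s))"
      using y t X by (intro exp_csqrt_product_integral) auto
    have "F y t = (of_real y powr z * of_real t powr (- 1 / 2) * U y * V t) *
       (exp (- 2 * csqrt ((of_real t + X) * (of_real y + X))) / csqrt (of_real y + X))"
      unfolding F_def U_def V_def by simp
    also have "\<dots> = c y * ((of_real t powr (- 1 / 2) * V t) *
        (LBINT s:{0<..}. exp (- (of_real y + X) * of_real s - (of_real t + X) / of_real s) / of_real (sqrt s)))"
      unfolding * c_def by (simp only: mult_ac)
    also have "(of_real t powr (- 1 / 2) * V t) *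
        (LBINT s:{0<..}. exp (- (of_real y + X) * of_real s - (of_real t + X) / of_real s) / of_real (sqrt s))
       = (LBINT s:{0<..}. H1 y s t)"
      unfolding set_integral_mult_right[symmetric]
    proof (rule set_lebesgue_integral_cong)
      show "\<forall>s. s \<in> {0<..} \<longrightarrow> of_real t powr (- 1 / 2) * V t *
         (exp (- (of_real y + X) * of_real s - (of_real t + X) / of_real s) / of_real (sqrt s)) = H1 y s t"
      proof (intro allI impI)
        fix s :: real assume "s \<in> {0<..}"
        have "exp (- (of_real y + X) * of_real s - (of_real t + X) / of_real s) =
           exp (- (of_real y + X) * of_real s - X / of_real s) * exp (- of_real (1 / s) * of_real t)"
          unfolding exp_add[symmetric] by (simp add: add_divide_distrib algebra_simps)
        then show "of_real t powr (- 1 / 2) * V t *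
         (exp (- (of_real y + X) * of_real s - (of_real t + X) / of_real s) / of_real (sqrt s)) = H1 y s t"
          unfolding H1_def g1_def by simp
      qed
    qed simp
    finally show ?thesis .
  qed
  have cond1: "set_integrable lborel {0<..} (\<lambda>s. norm (g1 y s) * (1 / s) powr (- Re (1/2)) * exp ((sqrt \<xi>)\<^sup>2 / (2 * (1 / s))))"
    if y: "y > 0" for y
  proof (rule set_integrable_bound[OF set_integrable_powr_exp[of 1 "\<xi> / 2"]])
    show "set_borel_measurable lborel {0<..} (\<lambda>s. norm (g1 y s) * (1 / s) powr (- Re (1/2)) * exp ((sqrt \<xi>)\<^sup>2 / (2 * (1 / s))))"
      unfolding set_borel_measurable_def g1_def by measurable
    have "norm (g1 y s) * (1 / s) powr (- Re (1/2)) * exp ((sqrt \<xi>)\<^sup>2 / (2 * (1 / s))) \<le> s powr (1 - 1) * exp (- (\<xi> / 2) * s)"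
      if s: "s > 0" for s
    proof -
      have "norm (g1 y s) = exp (- ((y + \<xi>) * s) - \<xi> / s) / sqrt s"
        using s by (simp add: g1_def norm_divide \<xi>_def algebra_simps)
      moreover have "(1 / s) powr (- Re (1/2)) = sqrt s"
        using s by (simp add: powr_divide powr_minus powr_half_sqrt)
      ultimately have "norm (g1 y s) * (1 / s) powr (- Re (1/2)) * exp ((sqrt \<xi>)\<^sup>2 / (2 * (1 / s)))
         = exp (- ((y + \<xi>) * s) - \<xi> / s) * exp (\<xi> * s / 2)"
        using s \<xi> by simp
      also have "\<dots> = exp (- ((y + \<xi>) * s) - \<xi> / s + \<xi> * s / 2)" by (simp only: exp_add)
      also have "\<dots> \<le> exp (- (\<xi> / 2) * s)"
        using s y \<xi> by (simp add: algebra_simps add_nonneg_nonneg)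
      finally show ?thesis using s by simp
    qed
    then show "AE s in lborel. s \<in> {0<..} \<longrightarrow> norm (norm (g1 y s) * (1 / s) powr (- Re (1/2)) * exp ((sqrt \<xi>)\<^sup>2 / (2 * (1 / s)))) \<le>
        norm (s powr (1 - 1) * exp (- (\<xi> / 2) * s))"
      by (intro AE_I2 impI) auto
  qed (use \<xi> in auto)
  have [measurable]: "g1 y \<in> borel_measurable borel" for y unfolding g1_def by measurable
  have fub1: "set_integrable lborel {0<..} (\<lambda>t. LBINT s:{0<..}. H1 y s t)"
     "(LBINT t:{0<..}. LBINT s:{0<..}. H1 y s t) = (LBINT s:{0<..}. LBINT t:{0<..}. H1 y s t)" if y: "y > 0" for y
    unfolding H1_def
    by (rule laplace_fubini[where k = "\<lambda>s. 1 / s" and C = CV and e = "sqrt \<xi>", OF _ _ _ _ _ CV(2,1) cond1[OF y]];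
        (measurable | simp))+
  show Fint: "set_integrable lborel {0<..} (F y)" if y: "y > 0" for y
    using set_integrable_mult_right[OF fub1(1)[OF y], of "c y"]
    by (rule set_integrable_cong[THEN iffD1, rotated 3]) (auto simp: F_eq[OF y])
  \<comment> \<open>The part of the kernel in \<open>s\<close> that is free of \<open>y\<close> once the integral over \<open>t\<close> is evaluated.\<close>
  define g2 where "g2 = (\<lambda>s. h s * exp (- X / of_real s))"
  define H2 where "H2 = (\<lambda>s y. g2 s * (of_real y powr ((1 + z) - 1) * exp (- of_real s * of_real y) * U y))"
  have inner: "(LBINT t:{0<..}. F y t) = (LBINT s:{0<..}. H2 s y)" if y: "y > 0" for y
  proof -
    have "(LBINT t:{0<..}. F y t) = (LBINT t:{0<..}. c y * (LBINT s:{0<..}. H1 y s t))"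
      by (rule set_lebesgue_integral_cong) (auto simp: F_eq[OF y])
    also have "\<dots> = c y * (LBINT s:{0<..}. LBINT t:{0<..}. H1 y s t)"
      by (simp only: set_integral_mult_right fub1(2)[OF y])
    also have "\<dots> = (LBINT s:{0<..}. c y * (LBINT t:{0<..}. H1 y s t))"
      by (simp only: set_integral_mult_right)
    also have "\<dots> = (LBINT s:{0<..}. H2 s y)"
    proof (rule set_lebesgue_integral_cong)
      show "\<forall>s. s \<in> {0<..} \<longrightarrow> c y * (LBINT t:{0<..}. H1 y s t) = H2 s y"
      proof (intro allI impI)
        fix s :: real assume "s \<in> {0<..}"
        then have s: "s > 0" by simp
        have "(LBINT t:{0<..}. H1 y s t) = g1 y s * (Gamma (1/2) * of_real (1 / s) powr (- (1/2)) * cos (k / of_real (sqrt (1 / s))))"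
          unfolding H1_def V_def set_integral_mult_right
          using laplace_hyp_0F2[of "1/2" "1 / s" k \<beta>] s k by simp
        also have "of_real (1 / s) powr (- (1/2)) = (of_real (sqrt s) :: complex)"
        proof -
          have "of_real (1 / s) powr (of_real (- (1/2))) = complex_of_real ((1 / s) powr (- (1/2)))"
            using s by (intro powr_of_real) auto
          also have "(1 / s) powr (- (1/2)) = sqrt s"
            using s by (simp add: powr_divide powr_minus powr_half_sqrt)
          finally show ?thesis by simp
        qed
        also have "k / of_real (sqrt (1 / s)) = k * of_real (sqrt s)"
          using s by (simp add: real_sqrt_divide)
        finally have 1: "(LBINT t:{0<..}. H1 y s t) = g1 y s * (of_real (sqrt pi) * of_real (sqrt s) * cos (k * of_real (sqrt s)))"
          by (simp only: Gamma_one_half_complex)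
        have 2: "g1 y s * of_real (sqrt s) = exp (- X * of_real s) * exp (- X / of_real s) * exp (- of_real s * of_real y)"
          using s unfolding g1_def exp_add[symmetric] by (simp add: algebra_simps)
        have "c y * (LBINT t:{0<..}. H1 y s t) = of_real y powr z * U y * (g1 y s * of_real (sqrt s)) * cos (k * of_real (sqrt s))"
          unfolding 1 c_def by simp
        also have "\<dots> = H2 s y"
          unfolding 2 H2_def g2_def h_def by simp
        finally show "c y * (LBINT t:{0<..}. H1 y s t) = H2 s y" .
      qed
    qed simp
    finally show ?thesis .
  qed
  have [measurable]: "g2 \<in> borel_measurable borel" unfolding g2_def h_def by measurable
  have cond2: "set_integrable lborel {0<..} (\<lambda>s. norm (g2 s) * s powr (- Re (1 + z)) * exp ((sqrt \<xi>)\<^sup>2 / (2 * s)))"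
  proof (rule set_integrable_bound[OF set_integrable_mult_right[OF set_integrable_powr_exp_both_ends[of "\<xi> / 2" "- Re (1 + z)"], of "exp ((norm k)\<^sup>2 / (2 * \<xi>))"]])
    show "set_borel_measurable lborel {0<..} (\<lambda>s. norm (g2 s) * s powr (- Re (1 + z)) * exp ((sqrt \<xi>)\<^sup>2 / (2 * s)))"
      unfolding set_borel_measurable_def by measurable
    have "norm (g2 s) * s powr (- Re (1 + z)) * exp ((sqrt \<xi>)\<^sup>2 / (2 * s)) \<le>
        exp ((norm k)\<^sup>2 / (2 * \<xi>)) * (s powr (- Re (1 + z)) * exp (- (\<xi> / 2) * s - \<xi> / 2 / s))" if s: "s > 0" for s
    proof -
      have e: "norm (exp (- X / of_real s)) = exp (- \<xi> / s)" by (simp add: \<xi>_def)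
      have "norm (g2 s) \<le> exp ((norm k)\<^sup>2 / (2 * \<xi>)) * exp (- (\<xi> / 2) * s) * exp (- \<xi> / s)"
        unfolding g2_def h_def norm_mult[of _ "exp (- X / of_real s)"] e
        by (intro mult_right_mono norm_exp_cos_sqrt_le[OF X s, folded \<xi>_def]) auto
      then have "norm (g2 s) * s powr (- Re (1 + z)) * exp ((sqrt \<xi>)\<^sup>2 / (2 * s)) \<le>
         exp ((norm k)\<^sup>2 / (2 * \<xi>)) * exp (- (\<xi> / 2) * s) * exp (- \<xi> / s) * s powr (- Re (1 + z)) * exp ((sqrt \<xi>)\<^sup>2 / (2 * s))"
        by (intro mult_right_mono) auto
      also have "\<dots> = exp ((norm k)\<^sup>2 / (2 * \<xi>)) * (s powr (- Re (1 + z)) * (exp (- (\<xi> / 2) * s) * exp (- \<xi> / s) * exp ((sqrt \<xi>)\<^sup>2 / (2 * s))))"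
        by (simp only: mult_ac)
      also have "exp (- (\<xi> / 2) * s) * exp (- \<xi> / s) * exp ((sqrt \<xi>)\<^sup>2 / (2 * s)) = exp (- (\<xi> / 2) * s - \<xi> / 2 / s)"
        unfolding exp_add[symmetric] using \<xi> s by (simp add: field_simps)
      finally show ?thesis .
    qed
    then show "AE s in lborel. s \<in> {0<..} \<longrightarrow> norm (norm (g2 s) * s powr (- Re (1 + z)) * exp ((sqrt \<xi>)\<^sup>2 / (2 * s))) \<le>
        norm (exp ((norm k)\<^sup>2 / (2 * \<xi>)) * (s powr (- Re (1 + z)) * exp (- (\<xi> / 2) * s - \<xi> / 2 / s)))"
      by (intro AE_I2 impI) (auto simp del: plus_complex.sel)
  qed (use \<xi> in auto)
  have b2: "Re (1 + z) > 0" using z by simp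
  have fub2: "set_integrable lborel {0<..} (\<lambda>y. LBINT s:{0<..}. H2 s y)"
     "(LBINT y:{0<..}. LBINT s:{0<..}. H2 s y) = (LBINT s:{0<..}. LBINT y:{0<..}. H2 s y)"
    unfolding H2_def
    by (rule laplace_fubini[where k = "\<lambda>s. s" and C = CU and e = "sqrt \<xi>", OF _ _ _ _ b2 CU(2,1) cond2];
        (measurable | simp))+
  show "set_integrable lborel {0<..} (\<lambda>y. LBINT t:{0<..}. F y t)"
    using fub2(1) by (rule set_integrable_cong[THEN iffD1, rotated 3]) (auto simp: inner)
  have "(LBINT y:{0<..}. LBINT t:{0<..}. F y t) = (LBINT y:{0<..}. LBINT s:{0<..}. H2 s y)"
    by (rule set_lebesgue_integral_cong) (auto simp: inner)
  also note fub2(2)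
  also have "(LBINT s:{0<..}. LBINT y:{0<..}. H2 s y) =
     (LBINT s:{0<..}. Gamma (1 + z) * (of_real s powr (- z - 1) * h s * h (1 / s)))"
  proof (rule set_lebesgue_integral_cong)
    show "\<forall>s. s \<in> {0<..} \<longrightarrow> (LBINT y:{0<..}. H2 s y) = Gamma (1 + z) * (of_real s powr (- z - 1) * h s * h (1 / s))"
    proof (intro allI impI)
      fix s :: real assume "s \<in> {0<..}"
      then have s: "s > 0" by simp
      have "(LBINT y:{0<..}. H2 s y) = g2 s * (Gamma (1 + z) * of_real s powr (- (1 + z)) * cos (k / of_real (sqrt s)))"
        unfolding H2_def U_def set_integral_mult_right
        using laplace_hyp_0F2[OF b2 s k] by simp
      also have "\<dots> = Gamma (1 + z) * (of_real s powr (- z - 1) * h s * h (1 / s))"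
      proof -
        have "- (1 + z) = - z - 1" by simp
        then show ?thesis
          unfolding g2_def h_def by (simp only:) (simp add: real_sqrt_divide)
      qed
      finally show "(LBINT y:{0<..}. H2 s y) = Gamma (1 + z) * (of_real s powr (- z - 1) * h s * h (1 / s))" .
    qed
  qed simp
  also have "\<dots> = Gamma (1 + z) * (LBINT s:{0<..}. of_real s powr (- z - 1) * h s * h (1 / s))"
    by (rule set_integral_mult_right)
  finally show "(LBINT y:{0<..}. LBINT t:{0<..}. F y t) =
      Gamma (1 + z) * (LBINT t:{0<..}. of_real t powr (- z - 1) * h t * h (1 / t))" .
qed

theorem theorem1p11:
  fixes w z x :: complex and c :: real
  assumes "Re z > -1"
    and "x \<noteq> 0" and "\<bar>Arg x\<bar> < pi / 4"
    and "c > \<bar>Re z\<bar>"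
  shows "let F = (\<lambda>(y::real) (t::real).
            of_real y powr z * of_real t powr (- 1 / 2) / csqrt (of_real y + x / 2)
            * exp (- 2 * csqrt ((of_real t + x / 2) * (of_real y + x / 2)))
            * hyp_0F2 (1 / 2) (1 + z) (- (w\<^sup>2 * x * of_real y / 8))
            * hyp_0F2 (1 / 2) (1 / 2) (- (w\<^sup>2 * x * of_real t / 8)))
         in vertical_integrable c (bessel_K_integrand z w x)
            \<and> (\<forall>y>0. set_integrable lborel {0<..} (F y))
            \<and> set_integrable lborel {0<..} (\<lambda>y. LBINT t:{0<..}. F y t)
            \<and> bessel_K c z w x =
                1 / (2 * Gamma (1 + z)) * (LBINT y:{0<..}. (LBINT t:{0<..}. F y t))"
proof -
  have "\<bar>Im (Ln x)\<bar> < pi / 2" using assms(2,3) by (simp add: Arg_eq_Im_Ln)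
  then have x: "Re x > 0" using Re_Ln_pos_lt[OF assms(2)] by simp
  then have X: "Re (x / 2) > 0" by simp
  define k where "k = w * csqrt (x / 2)"
  have k: "k\<^sup>2 = w\<^sup>2 * (x / 2)" "k\<^sup>2 = 4 * (w\<^sup>2 * x / 8)" by (simp_all add: k_def power_mult_distrib)
  have \<beta>: "w\<^sup>2 * x / 8 * u = w\<^sup>2 * x * u / 8" for u by simp
  have "Gamma (1 + z) \<noteq> 0"
  proof
    assume "Gamma (1 + z) = 0"
    then obtain n where n: "1 + z = of_int n" "n \<le> 0"
      by (auto simp: Gamma_eq_zero_iff elim!: nonpos_Ints_cases)
    have "1 + Re z = Re (1 + z)" by simp
    also have "\<dots> = of_int n" unfolding n(1) by simp
    also have "\<dots> \<le> 0" using n(2) by simp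
    finally show False using assms(1) by simp
  qed
  then show ?thesis
    unfolding Let_def
    using bessel_K_single_integral[OF x assms(4) k(1)] iterated_integral_single_integral[OF X assms(1) k(2), unfolded \<beta>]
    by simp
qed

end
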